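(* Let $X=(X_1,\dots,X_{n+1})$ be an $(n+1)$-class birth and death process with strictly positive (constant) birth rates $\lambda_1,\dots,\lambda_{n+1}$ and bounded death rates $\phi_1,\dots,\phi_{n+1}:\mathbb{Z}_+^{n+1}\to\mathbb{R}_+$ such that $\phi_i(x)=\phi_i(x_1,\dots,x_n)$ only depends on the first $n$ input arguments for all $i=1,\dots,n$. Assume that: (i) The Markov process $X^n=(X_1,\dots,X_n)$ is stable and has the stationary distribution $\pi$. (ii) The birth rate of $X_{n+1}$ satisfies $$\lambda_{n+1}<\sum_{x^n\in\mathbb{Z}_+^n}\left\{\liminf_{x_{n+1}\to\infty}\phi_{n+1}(x^n,x_{n+1})\right\}\pi(x^n).$$ Then the process $X=(X^n,X_{n+1})$ is stable. In particular, if (i) holds and $\phi_{n+1}(x)=\phi_{n+1}(x_{n+1})$ only depends on $x_{n+1}$, then $$\lambda_{n+1}<\liminf_{x_{n+1}\to\infty}\phi_{n+1}(x_{n+1})$$ is sufficient for the stability of $X^{n+1}=(X_1,\dots,X_{n+1})$, regardless of the initial state.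
   Context: $n\ge0$ is an integer; for $n=0$, $\mathbb{Z}_+^0$ is a single point, (i) is vacuous, and $\pi$ is the unit mass at that point. $\mathbb{Z}_+=\{0,1,2,\dots\}$, $\mathbb{R}_+=[0,\infty)$. An $N$-class birth and death process with birth rates $\lambda_i$ and death rates $\phi_i(x)$ is the continuous-time Markov process on $\mathbb{Z}_+^N$ (with right-continuous paths with left limits) having transitions $x\mapsto x+e_i$ at rate $\lambda_i$ and $x\mapsto x-e_i$ at rate $\phi_i(x)1(x_i>0)$, $i=1,\dots,N$, where $e_i$ is the $i$-th unit vector. A stochastic process $U$ with values in a countable space $S$ is stable if for every $\epsilon>0$ there is a finite set $K\subset S$ such that $\Pr(U(t)\notin K)\le\epsilon$ for all $t\ge0$. *)

theory Defs
  imports "HOL-Probability.Probability"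
begin

(* A rate kernel q gives the off-diagonal jump rates on a countable state space S; its diagonal
   is never used, so the total jump rate out of x is the sum of q x y over y in S - {x}. *)
definition transition_semigroup ::
    "'a set \<Rightarrow> ('a \<Rightarrow> 'a \<Rightarrow> real) \<Rightarrow> (real \<Rightarrow> 'a \<Rightarrow> 'a pmf) \<Rightarrow> bool" where
  "transition_semigroup S q p \<longleftrightarrow>
     (\<forall>t\<ge>0. \<forall>x\<in>S. set_pmf (p t x) \<subseteq> S) \<and>
     (\<forall>x\<in>S. p 0 x = return_pmf x) \<and>
     (\<forall>s\<ge>0. \<forall>t\<ge>0. \<forall>x\<in>S. p (s + t) x = bind_pmf (p s x) (p t)) \<and>
     (\<forall>x\<in>S. \<forall>y\<in>S. x \<noteq> y \<longrightarrow>
        ((\<lambda>h. pmf (p h x) y) has_real_derivative q x y) (at_right 0)) \<and>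
     (\<forall>x\<in>S.
        ((\<lambda>h. pmf (p h x) x) has_real_derivative - (\<Sum>\<^sub>\<infinity>y\<in>S - {x}. q x y)) (at_right 0))"

definition natural_filtration ::
    "'w measure \<Rightarrow> (real \<Rightarrow> 'w \<Rightarrow> 'a) \<Rightarrow> real \<Rightarrow> 'w measure" where
  "natural_filtration M X s = sigma (space M) {X u -` A \<inter> space M | u A. 0 \<le> u \<and> u \<le> s}"

(* Only times t >= 0 are meaningful; the values of X at negative times are ignored. *)
definition markov_process ::
    "'w measure \<Rightarrow> 'a set \<Rightarrow> (real \<Rightarrow> 'a \<Rightarrow> 'a pmf) \<Rightarrow> (real \<Rightarrow> 'w \<Rightarrow> 'a) \<Rightarrow> bool" where
  "markov_process M S p X \<longleftrightarrow>
     prob_space M \<and>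
     (\<forall>t\<ge>0. X t \<in> measurable M (count_space UNIV)) \<and>
     (\<forall>t\<ge>0. \<forall>\<omega>\<in>space M. X t \<omega> \<in> S) \<and>
     (\<forall>s\<ge>0. \<forall>t\<ge>0. \<forall>y\<in>S. AE \<omega> in M.
        real_cond_exp M (natural_filtration M X s)
          (indicator {\<omega>' \<in> space M. X (s + t) \<omega>' = y}) \<omega> = pmf (p t (X s \<omega>)) y)"

(* Right-continuity and left limits with respect to the discrete topology on the state space:
   a path converges iff it is eventually constant. *)
definition cadlag_paths :: "'w measure \<Rightarrow> (real \<Rightarrow> 'w \<Rightarrow> 'a) \<Rightarrow> bool" where
  "cadlag_paths M X \<longleftrightarrow>
     (\<forall>\<omega>\<in>space M.
        (\<forall>t\<ge>0. eventually (\<lambda>s. X s \<omega> = X t \<omega>) (at_right t)) \<and>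
        (\<forall>t>0. \<exists>y. eventually (\<lambda>s. X s \<omega> = y) (at_left t)))"

definition jump_process ::
    "'w measure \<Rightarrow> 'a set \<Rightarrow> ('a \<Rightarrow> 'a \<Rightarrow> real) \<Rightarrow> (real \<Rightarrow> 'w \<Rightarrow> 'a) \<Rightarrow> bool" where
  "jump_process M S q X \<longleftrightarrow>
     (\<exists>p. transition_semigroup S q p \<and> markov_process M S p X) \<and> cadlag_paths M X"

(* Stationarity is invariance under the semigroup of the Markov process with rates q.  For
   bounded rates, as for the birth and death processes below, that semigroup is unique on S. *)
definition stationary_distribution ::
    "'a set \<Rightarrow> ('a \<Rightarrow> 'a \<Rightarrow> real) \<Rightarrow> 'a pmf \<Rightarrow> bool" where
  "stationary_distribution S q \<pi> \<longleftrightarrow>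
     set_pmf \<pi> \<subseteq> S \<and>
     (\<exists>p. transition_semigroup S q p \<and> (\<forall>t\<ge>0. bind_pmf \<pi> (p t) = \<pi>))"

definition stable_process :: "'w measure \<Rightarrow> 'a set \<Rightarrow> (real \<Rightarrow> 'w \<Rightarrow> 'a) \<Rightarrow> bool" where
  "stable_process M S U \<longleftrightarrow>
     (\<forall>\<epsilon>>0. \<exists>K. finite K \<and> K \<subseteq> S \<and>
        (\<forall>t\<ge>0. measure M {\<omega> \<in> space M. U t \<omega> \<notin> K} \<le> \<epsilon>))"

(* The lattice of N-tuples of natural numbers; coordinates are numbered 0, ..., N - 1, and for
   N = 0 it is the single point []. *)
definition states :: "nat \<Rightarrow> nat list set" where
  "states N = {x. length x = N}"

definition birth_death_rate ::
    "nat \<Rightarrow> (nat \<Rightarrow> real) \<Rightarrow> (nat \<Rightarrow> nat list \<Rightarrow> real) \<Rightarrow> nat list \<Rightarrow> nat list \<Rightarrow> real" where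
  "birth_death_rate N lam phi x y =
     (\<Sum>i<N. (if y = x[i := x ! i + 1] then lam i else 0) +
             (if x ! i > 0 \<and> y = x[i := x ! i - 1] then phi i x else 0))"

definition birth_death_process ::
    "'w measure \<Rightarrow> nat \<Rightarrow> (nat \<Rightarrow> real) \<Rightarrow> (nat \<Rightarrow> nat list \<Rightarrow> real) \<Rightarrow>
     (real \<Rightarrow> 'w \<Rightarrow> nat list) \<Rightarrow> bool" where
  "birth_death_process M N lam phi X \<longleftrightarrow>
     jump_process M (states N) (birth_death_rate N lam phi) X"

(* Death rates of the first n classes as functions of n-tuples.  Meaningful when phi i ignores
   the last coordinate for i < n, in which case the appended 0 is immaterial and the first n
   coordinates of the process with rates phi form the n-class process with these rates. *)
definition marginal_rates :: "(nat \<Rightarrow> nat list \<Rightarrow> real) \<Rightarrow> nat \<Rightarrow> nat list \<Rightarrow> real" where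
  "marginal_rates phi i x = phi i (x @ [0])"

end

(* Uniformization replaces the semigroup p of a process with bounded rates by the discrete kernel U
   with U x y = q x y / c off the diagonal: p h exceeds (1 - c h) I + c h (1 - c h) U, whose mass
   deficit is only (c h)^2, so tightness of the laws mu U^k carries over to the laws mu p_t, and a
   distribution stationary for p is stationary for U.

   If U has a stationary distribution nu, then U^k(x, .) <= nu / nu(x) for x in the support of nu.
   All birth rates being positive, the support is reached from every state, in a fixed number of
   steps, with probability bounded away from zero.  Hence every initial law gives a tight orbit.

   To find nu, start the (n+1)-class chain from pi x delta_0, so that its first n coordinates keep
   the law pi.  The last coordinate has nonnegative mean, while its drift would be at most
   lam n - sum_x g(x) pi(x) < 0 if it stayed above m; hence the Cesaro means of the laws charge a
   fixed finite set, and a nonzero pointwise limit point of them is a finite measure nu with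
   nu U <= nu, hence nu U = nu. *)
theory Submission
  imports Defs
begin

section \<open>Bounds for probability mass functions\<close>

text \<open>A semigroup is given here only by its semigroup law and by right derivatives at time 0
  of single entries; there is no control of sums over infinitely many states. Entrywise lower bounds
  survive this, being obtained by following a few paths along a fine time grid, and they are enough:
  laws have total mass 1, so an entrywise inequality between two of them is an equality, and
  tightness is itself a lower bound on the mass of finite sets. Uniformized kernels depend on the
  rates alone, so they also tie the semigroup of the process to the one that witnesses stationarity
  of \<open>\<pi>\<close>. Death rates may vanish, so the chain may be reducible, with states
  outside the support of the invariant law. What remains is additive: if \<open>r\<close> lies in
  that support, then \<open>x\<close> reaches \<open>x + r\<close> by births, in a number of steps
  that depends on \<open>r\<close> only; \<open>r\<close> reaches the same state, which therefore
  lies in the support. Uniformizing the n-class and the (n+1)-class chains with one constant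
  \<open>c\<close> makes the first kernel the exact projection of the second.\<close>

lemma measure_bind_pmf:
  "measure_pmf.prob (bind_pmf M N) A = (\<integral>x. measure_pmf.prob (N x) A \<partial>measure_pmf M)"
proof -
  have "ennreal (measure_pmf.prob (bind_pmf M N) A) = (\<integral>\<^sup>+x. measure_pmf.prob (N x) A \<partial>measure_pmf M)"
    by (simp flip: measure_pmf.emeasure_eq_measure)
  also have "\<dots> = ennreal (\<integral>x. measure_pmf.prob (N x) A \<partial>measure_pmf M)"
    by (intro nn_integral_eq_integral measure_pmf.integrable_const_bound[where B = 1]) auto
  finally show ?thesis
    by (simp add: integral_nonneg_AE)
qed

lemma integrable_pmf_bounded:
  fixes f :: "'a \<Rightarrow> real"
  assumes "\<And>x. x \<in> set_pmf M \<Longrightarrow> \<bar>f x\<bar> \<le> B"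
  shows "integrable (measure_pmf M) f"
  by (rule measure_pmf.integrable_const_bound[where B = B]) (auto simp: AE_measure_pmf_iff assms)

lemma integral_pmf_mono:
  fixes f g :: "'a \<Rightarrow> real"
  assumes "integrable (measure_pmf M) f" "integrable (measure_pmf M) g"
    and "\<And>x. x \<in> set_pmf M \<Longrightarrow> f x \<le> g x"
  shows "(\<integral>x. f x \<partial>measure_pmf M) \<le> (\<integral>x. g x \<partial>measure_pmf M)"
  using assms by (intro integral_mono_AE) (auto simp: AE_measure_pmf_iff)

lemma pmf_bind_ge_sum:
  assumes "finite F"
  shows "(\<Sum>z\<in>F. pmf M z * pmf (N z) y) \<le> pmf (bind_pmf M N) y"
proof -
  have "(\<Sum>z\<in>F. pmf M z * pmf (N z) y) = (\<integral>z. indicator F z * pmf (N z) y \<partial>measure_pmf M)"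
    by (subst integral_measure_pmf_real[OF assms]) (auto simp: mult.commute split: split_indicator_asm)
  also have "\<dots> \<le> (\<integral>z. pmf (N z) y \<partial>measure_pmf M)"
    by (intro integral_pmf_mono integrable_pmf_bounded[where B = 1])
       (auto simp: pmf_le_1 split: split_indicator)
  also have "\<dots> = pmf (bind_pmf M N) y"
    by (simp add: pmf_bind)
  finally show ?thesis .
qed

lemma pmf_bind_ge:
  "pmf M z * pmf (N z) y \<le> pmf (bind_pmf M N) y"
  using pmf_bind_ge_sum[of "{z}" M N y] by simp

lemma pmf_bind_ge2:
  assumes "x \<noteq> y"
  shows "pmf M x * pmf (N x) z + pmf M y * pmf (N y) z \<le> pmf (bind_pmf M N) z"
  using pmf_bind_ge_sum[of "{x, y}" M N z] assms by simp

lemma prob_pmf_mono: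
  assumes "0 \<le> a" "\<And>y. a * pmf M y \<le> pmf N y"
  shows "a * measure_pmf.prob M A \<le> measure_pmf.prob N A"
proof -
  have "ennreal (a * measure_pmf.prob M A) = ennreal a * (\<integral>\<^sup>+ y. pmf M y \<partial>count_space A)"
    using assms(1) by (simp add: nn_integral_pmf measure_pmf.emeasure_eq_measure ennreal_mult)
  also have "\<dots> = (\<integral>\<^sup>+ y. a * pmf M y \<partial>count_space A)"
    using assms(1) by (simp add: nn_integral_cmult ennreal_mult)
  also have "\<dots> \<le> (\<integral>\<^sup>+ y. pmf N y \<partial>count_space A)"
    by (intro nn_integral_mono ennreal_leI assms(2))
  finally show ?thesis
    by (simp add: nn_integral_pmf measure_pmf.emeasure_eq_measure)
qed

text \<open>Both sides have total mass 1, so an excess at \<open>y\<close> would force a deficit on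
  the complement of \<open>y\<close>. The invariance of laws and the law of the process at time
  \<open>t\<close> are proved through this one-sided test.\<close>

lemma pmf_eqI_le:
  assumes "\<And>y. pmf M y \<le> pmf N y"
  shows "M = N"
proof (rule pmf_eqI)
  fix y
  have "measure_pmf.prob M (-{y}) \<le> measure_pmf.prob N (-{y})"
    using prob_pmf_mono[of 1 M N] assms by simp
  then have "pmf N y \<le> pmf M y"
    using measure_pmf.prob_compl[of "{y}" M] measure_pmf.prob_compl[of "{y}" N]
    by (simp add: Compl_eq_Diff_UNIV measure_pmf_single)
  with assms show "pmf M y = pmf N y" by (simp add: order.antisym)
qed

lemma pmf_finite_approx:
  assumes "0 < \<epsilon>"
  shows "\<exists>K. finite K \<and> K \<subseteq> set_pmf M \<and> 1 - \<epsilon> \<le> measure_pmf.prob M K"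
proof -
  define f where "f = from_nat_into (set_pmf M)"
  have range: "range f = set_pmf M"
    unfolding f_def by (intro range_from_nat_into set_pmf_not_empty countable_set_pmf)
  have "(\<lambda>n. measure_pmf.prob M (f ` {..<n})) \<longlonglongrightarrow> measure_pmf.prob M (\<Union>n. f ` {..<n})"
    by (intro measure_pmf.finite_Lim_measure_incseq) (auto simp: incseq_def)
  moreover have "(\<Union>n. f ` {..<n}) = set_pmf M"
    unfolding range[symmetric] by auto
  moreover have "measure_pmf.prob M (set_pmf M) = 1"
    by (simp add: measure_pmf.prob_eq_1 AE_measure_pmf)
  ultimately have "(\<lambda>n. measure_pmf.prob M (f ` {..<n})) \<longlonglongrightarrow> 1" by simp
  then have "eventually (\<lambda>n. 1 - \<epsilon> < measure_pmf.prob M (f ` {..<n})) sequentially"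
    using assms by (intro order_tendstoD) auto
  then obtain n where "1 - \<epsilon> < measure_pmf.prob M (f ` {..<n})"
    by (auto simp: eventually_sequentially)
  then show ?thesis
    using range by (intro exI[of _ "f ` {..<n}"]) auto
qed

section \<open>Orbits of a discrete kernel\<close>

primrec kernel_pow :: "('a \<Rightarrow> 'a pmf) \<Rightarrow> nat \<Rightarrow> 'a \<Rightarrow> 'a pmf" where
  "kernel_pow U 0 x = return_pmf x"
| "kernel_pow U (Suc k) x = bind_pmf (kernel_pow U k x) U"

lemma kernel_pow_add:
  "kernel_pow U (j + k) x = bind_pmf (kernel_pow U j x) (kernel_pow U k)"
  by (induction k) (simp_all add: bind_return_pmf' bind_assoc_pmf)

lemma kernel_pow_1 [simp]: "kernel_pow U (Suc 0) = U"
  by (rule ext) (simp add: bind_return_pmf)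

lemma kernel_pow_Suc_left: "kernel_pow U (Suc k) x = bind_pmf (U x) (kernel_pow U k)"
  using kernel_pow_add[of U 1 k x] by simp

lemma set_kernel_pow_subset:
  assumes "\<And>x. x \<in> S \<Longrightarrow> set_pmf (U x) \<subseteq> S" "x \<in> S"
  shows "set_pmf (kernel_pow U k x) \<subseteq> S"
  using assms(2) by (induction k) (use assms(1) in \<open>auto simp: subset_iff\<close>)

lemma bind_kernel_pow_stationary:
  assumes "bind_pmf \<nu> U = \<nu>"
  shows "bind_pmf \<nu> (kernel_pow U k) = \<nu>"
proof (induction k)
  case 0
  then show ?case
    by (metis (mono_tags) bind_return_pmf' kernel_pow.simps(1) bind_pmf_cong)
next
  case (Suc k)
  have "bind_pmf \<nu> (kernel_pow U (Suc k)) = bind_pmf (bind_pmf \<nu> (kernel_pow U k)) U"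
    unfolding bind_assoc_pmf by (intro bind_pmf_cong) simp_all
  also have "\<dots> = \<nu>" by (simp only: Suc assms)
  finally show ?case .
qed

section \<open>Tightness of orbits relative to an invariant law\<close>

definition tight_orbit :: "('a \<Rightarrow> 'a pmf) \<Rightarrow> 'a pmf \<Rightarrow> bool" where
  "tight_orbit U \<mu> \<longleftrightarrow>
     (\<forall>\<epsilon>>0. \<exists>K. finite K \<and> (\<forall>k. 1 - \<epsilon> \<le> measure_pmf.prob (bind_pmf \<mu> (kernel_pow U k)) K))"

lemma prob_Compl_pmf: "measure_pmf.prob M (- A) = 1 - measure_pmf.prob M A"
  using measure_pmf.prob_compl[of A M] by (simp add: Compl_eq_Diff_UNIV)

lemma tight_orbit_stationary_support:
  assumes "bind_pmf \<nu> U = \<nu>" and "x \<in> set_pmf \<nu>"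
  shows "tight_orbit U (return_pmf x)"
  unfolding tight_orbit_def
proof (intro allI impI)
  fix \<epsilon> :: real assume "0 < \<epsilon>"
  have pos: "0 < pmf \<nu> x" using assms(2) by (simp add: pmf_positive)
  \<comment> \<open>The allowed loss is scaled by \<open>pmf \<nu> x\<close> because the domination
    of \<open>kernel_pow U k x\<close> by \<open>\<nu>\<close> divides by this weight.\<close>
  obtain K where K: "finite K" "1 - \<epsilon> * pmf \<nu> x \<le> measure_pmf.prob \<nu> K"
    using pmf_finite_approx[OF mult_pos_pos[OF \<open>0 < \<epsilon>\<close> pos], of \<nu>] by blast
  have "1 - \<epsilon> \<le> measure_pmf.prob (kernel_pow U k x) K" for k
  proof -
    have "pmf \<nu> x * pmf (kernel_pow U k x) y \<le> pmf \<nu> y" for y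
      using pmf_bind_ge[of \<nu> x "kernel_pow U k" y] bind_kernel_pow_stationary[OF assms(1), of k]
      by simp
    then have "pmf \<nu> x * measure_pmf.prob (kernel_pow U k x) (-K) \<le> measure_pmf.prob \<nu> (-K)"
      by (intro prob_pmf_mono) auto
    also have "\<dots> \<le> pmf \<nu> x * \<epsilon>" using K(2) by (simp add: prob_Compl_pmf mult.commute)
    finally have "measure_pmf.prob (kernel_pow U k x) (-K) \<le> \<epsilon>"
      using pos by (simp add: mult_le_cancel_left_pos)
    then show ?thesis by (simp add: prob_Compl_pmf)
  qed
  with K(1) show "\<exists>K. finite K \<and>
      (\<forall>k. 1 - \<epsilon> \<le> measure_pmf.prob (bind_pmf (return_pmf x) (kernel_pow U k)) K)"
    by (auto simp: bind_return_pmf)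
qed

text \<open>The law \<open>\<nu>\<close> charges every state reached from a state that it charges,
  so its support is closed under the kernel.\<close>

lemma set_kernel_pow_stationary_support:
  assumes "bind_pmf \<nu> U = \<nu>" and "x \<in> set_pmf \<nu>"
  shows "set_pmf (kernel_pow U k x) \<subseteq> set_pmf \<nu>"
proof -
  have "set_pmf (bind_pmf \<nu> (kernel_pow U k)) = set_pmf \<nu>"
    by (simp only: bind_kernel_pow_stationary[OF assms(1)])
  then show ?thesis using assms(2) by auto
qed

text \<open>Blocks of \<open>d\<close> steps act as successive trials, each hitting the support with
  probability at least \<open>\<delta>\<close>. As the support is closed, missing it after
  \<open>Suc j\<close> blocks means missing it after the first block and again after
  \<open>j\<close> more.\<close>

lemma prob_avoid_stationary_support:
  assumes stat: "bind_pmf \<nu> U = \<nu>"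
    and U_S: "\<And>x. x \<in> S \<Longrightarrow> set_pmf (U x) \<subseteq> S"
    and reach: "\<And>x. x \<in> S \<Longrightarrow> \<delta> \<le> measure_pmf.prob (kernel_pow U d x) (set_pmf \<nu>)"
    and "\<delta> \<le> 1" "x \<in> S"
  shows "measure_pmf.prob (kernel_pow U (j * d) x) (- set_pmf \<nu>) \<le> (1 - \<delta>) ^ j"
  using \<open>x \<in> S\<close>
proof (induction j arbitrary: x)
  case 0
  then show ?case by simp
next
  case (Suc j)
  let ?P = "\<lambda>z. measure_pmf.prob (kernel_pow U (j * d) z) (- set_pmf \<nu>)"
  have "measure_pmf.prob (kernel_pow U (Suc j * d) x) (- set_pmf \<nu>)
      = (\<integral>z. ?P z \<partial>measure_pmf (kernel_pow U d x))"
    by (simp add: kernel_pow_add measure_bind_pmf)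
  also have "\<dots> \<le> (\<integral>z. (1 - \<delta>) ^ j * indicator (- set_pmf \<nu>) z \<partial>measure_pmf (kernel_pow U d x))"
  proof (intro integral_pmf_mono)
    fix z assume z: "z \<in> set_pmf (kernel_pow U d x)"
    then have "z \<in> S" using set_kernel_pow_subset[of S U x d] U_S Suc.prems by auto
    show "?P z \<le> (1 - \<delta>) ^ j * indicator (- set_pmf \<nu>) z"
    proof (cases "z \<in> set_pmf \<nu>")
      case True
      have "?P z = 0"
        using set_kernel_pow_stationary_support[OF stat True, of "j * d"]
        by (auto simp: measure_pmf_zero_iff)
      then show ?thesis using True by simp
    qed (use Suc.IH[OF \<open>z \<in> S\<close>] in simp)
  qed (auto intro!: integrable_pmf_bounded[where B = 1] integrable_mult_right split: split_indicator)
  also have "\<dots> = (1 - \<delta>) ^ j * measure_pmf.prob (kernel_pow U d x) (- set_pmf \<nu>)"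
    by simp
  also have "\<dots> \<le> (1 - \<delta>) ^ j * (1 - \<delta>)"
    using reach[OF Suc.prems] \<open>\<delta> \<le> 1\<close>
    by (intro mult_left_mono) (auto simp: prob_Compl_pmf)
  finally show ?case by (simp add: mult.commute)
qed

text \<open>The finite sets for single starting points vary with the point, and the support may be
  infinite. After a fixed time \<open>k0\<close>, however, most of the mass lies in a finite part
  \<open>F\<close> of the support, whose finitely many tight orbits share one finite set; the
  finitely many earlier times are covered separately.\<close>

theorem tight_orbit_if_reaches_stationary_support:
  assumes stat: "bind_pmf \<nu> U = \<nu>"
    and U_S: "\<And>x. x \<in> S \<Longrightarrow> set_pmf (U x) \<subseteq> S"
    and reach: "\<And>x. x \<in> S \<Longrightarrow> \<delta> \<le> measure_pmf.prob (kernel_pow U d x) (set_pmf \<nu>)"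
    and "0 < \<delta>" "set_pmf \<mu> \<subseteq> S"
  shows "tight_orbit U \<mu>"
  unfolding tight_orbit_def
proof (intro allI impI)
  fix \<epsilon> :: real assume \<epsilon>: "0 < \<epsilon>"
  \<comment> \<open>The losses are \<open>\<eta>\<close> off the support, \<open>\<eta>\<close>
    outside \<open>F0\<close> and \<open>\<eta>\<close> along the orbits; the final product is at
    least \<open>1 - 3 * \<eta>\<close>. The cap at 1 keeps the factor \<open>1 - \<eta>\<close>
    nonnegative.\<close>
  define \<eta> where "\<eta> = min (\<epsilon> / 4) 1"
  have \<eta>: "0 < \<eta>" "\<eta> \<le> 1" "4 * \<eta> \<le> \<epsilon>" using \<epsilon> by (auto simp: \<eta>_def)
  obtain x0 where "x0 \<in> S" using \<open>set_pmf \<mu> \<subseteq> S\<close> set_pmf_not_empty[of \<mu>] by blast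
  then have \<delta>: "0 < \<delta>" "\<delta> \<le> 1" using reach[of x0] \<open>0 < \<delta>\<close> by (auto intro: order_trans)
  have "(\<lambda>j. (1 - \<delta>) ^ j) \<longlonglongrightarrow> 0" using \<delta> by (intro LIMSEQ_realpow_zero) auto
  then have "eventually (\<lambda>j. (1 - \<delta>) ^ j < \<eta>) sequentially"
    using \<eta> by (intro order_tendstoD) auto
  then obtain j where j: "(1 - \<delta>) ^ j < \<eta>" by (auto simp: eventually_sequentially)
  define k0 where "k0 = j * d"
  define \<sigma> where "\<sigma> = bind_pmf \<mu> (kernel_pow U k0)"
  have "measure_pmf.prob \<sigma> (- set_pmf \<nu>) \<le> (\<integral>z. \<eta> \<partial>measure_pmf \<mu>)"
    unfolding \<sigma>_def measure_bind_pmf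
  proof (intro integral_pmf_mono)
    fix z assume "z \<in> set_pmf \<mu>"
    then have "z \<in> S" using \<open>set_pmf \<mu> \<subseteq> S\<close> by auto
    from prob_avoid_stationary_support[OF stat U_S reach \<open>\<delta> \<le> 1\<close> this, of j] j
    show "measure_pmf.prob (kernel_pow U k0 z) (- set_pmf \<nu>) \<le> \<eta>" by (simp add: k0_def)
  qed (auto intro!: integrable_pmf_bounded[where B = 1])
  then have avoid: "measure_pmf.prob \<sigma> (- set_pmf \<nu>) \<le> \<eta>" by simp
  obtain F0 where F0: "finite F0" "1 - \<eta> \<le> measure_pmf.prob \<sigma> F0"
    using pmf_finite_approx[OF \<eta>(1), of \<sigma>] by blast
  define F where "F = F0 \<inter> set_pmf \<nu>"
  have "measure_pmf.prob \<sigma> F0 \<le> measure_pmf.prob \<sigma> (F \<union> - set_pmf \<nu>)"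
    by (intro measure_pmf.finite_measure_mono) (auto simp: F_def)
  also have "\<dots> \<le> measure_pmf.prob \<sigma> F + measure_pmf.prob \<sigma> (- set_pmf \<nu>)"
    by (intro measure_Un_le) auto
  finally have F: "1 - 2 * \<eta> \<le> measure_pmf.prob \<sigma> F" using F0(2) avoid by simp
  have "\<exists>K. finite K \<and> (\<forall>k. 1 - \<eta> \<le> measure_pmf.prob (kernel_pow U k x) K)" if "x \<in> F" for x
    using tight_orbit_stationary_support[OF stat, of x] that \<eta>(1)
    by (auto simp: F_def tight_orbit_def bind_return_pmf)
  then obtain K where K: "\<And>x. x \<in> F \<Longrightarrow> finite (K x)"
      "\<And>x k. x \<in> F \<Longrightarrow> 1 - \<eta> \<le> measure_pmf.prob (kernel_pow U k x) (K x)"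
    by metis
  have "\<exists>L. finite L \<and> 1 - \<epsilon> \<le> measure_pmf.prob (bind_pmf \<mu> (kernel_pow U k)) L" for k
    using pmf_finite_approx[OF \<epsilon>] by metis
  then obtain L where L: "\<And>k. finite (L k)"
      "\<And>k. 1 - \<epsilon> \<le> measure_pmf.prob (bind_pmf \<mu> (kernel_pow U k)) (L k)"
    by metis
  define C where "C = (\<Union>x\<in>F. K x) \<union> (\<Union>k<k0. L k)"
  have "finite C" using K(1) L(1) F0(1) by (auto simp: C_def F_def)
  moreover have "1 - \<epsilon> \<le> measure_pmf.prob (bind_pmf \<mu> (kernel_pow U k)) C" for k
  proof (cases "k < k0")
    case True
    then have "measure_pmf.prob (bind_pmf \<mu> (kernel_pow U k)) (L k)
        \<le> measure_pmf.prob (bind_pmf \<mu> (kernel_pow U k)) C"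
      by (intro measure_pmf.finite_measure_mono) (auto simp: C_def)
    with L(2)[of k] show ?thesis by simp
  next
    case False
    define m where "m = k - k0"
    have "bind_pmf \<mu> (kernel_pow U k) = bind_pmf \<sigma> (kernel_pow U m)"
      using False by (simp add: \<sigma>_def m_def bind_assoc_pmf flip: kernel_pow_add)
    moreover have "(\<integral>z. (1 - \<eta>) * indicator F z \<partial>measure_pmf \<sigma>)
        \<le> measure_pmf.prob (bind_pmf \<sigma> (kernel_pow U m)) C"
      unfolding measure_bind_pmf
    proof (intro integral_pmf_mono)
      fix z assume "z \<in> set_pmf \<sigma>"
      show "(1 - \<eta>) * indicator F z \<le> measure_pmf.prob (kernel_pow U m z) C"
      proof (cases "z \<in> F")
        case True
        then have "measure_pmf.prob (kernel_pow U m z) (K z) \<le> measure_pmf.prob (kernel_pow U m z) C"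
          by (intro measure_pmf.finite_measure_mono) (auto simp: C_def)
        with K(2)[OF True, of m] show ?thesis using True by simp
      qed simp
    qed (auto intro!: integrable_pmf_bounded[where B = 1] integrable_mult_right split: split_indicator)
    moreover have "(1 - \<eta>) * (1 - 2 * \<eta>) \<le> (1 - \<eta>) * measure_pmf.prob \<sigma> F"
      using F \<eta> by (intro mult_left_mono) auto
    moreover have "1 - \<epsilon> \<le> (1 - \<eta>) * (1 - 2 * \<eta>)"
    proof -
      have "(1 - \<eta>) * (1 - 2 * \<eta>) = 1 - 3 * \<eta> + 2 * \<eta>\<^sup>2"
        by (simp add: algebra_simps power2_eq_square)
      then show ?thesis using \<eta> zero_le_power2[of \<eta>] by linarith
    qed
    ultimately show ?thesis by simp
  qed
  ultimately show "\<exists>K. finite K \<and>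
      (\<forall>k. 1 - \<epsilon> \<le> measure_pmf.prob (bind_pmf \<mu> (kernel_pow U k)) K)" by blast
qed

text \<open>The averages are not assumed tight, so part of their mass may escape in a pointwise
  limit \<open>v\<close>. The bound on \<open>K\<close> keeps \<open>v\<close> nonzero, while
  passing to the limit in finite partial sums leaves only \<open>v U \<le> v\<close>. After
  normalization both sides are probability laws, which forces equality.\<close>

theorem stationary_from_cesaro_mass:
  fixes U :: "'a :: countable \<Rightarrow> 'a pmf"
  assumes "finite K" "0 < \<kappa>"
    and mass: "\<And>T. \<kappa> * real T \<le> (\<Sum>k<T. measure_pmf.prob (bind_pmf \<rho> (kernel_pow U k)) K)"
    and supp: "\<And>k. set_pmf (bind_pmf \<rho> (kernel_pow U k)) \<subseteq> S"
  obtains \<nu> where "bind_pmf \<nu> U = \<nu>" "set_pmf \<nu> \<subseteq> S"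
proof -
  define r where "r k = bind_pmf \<rho> (kernel_pow U k)" for k
  have r_Suc: "r (Suc k) = bind_pmf (r k) U" for k
    unfolding r_def bind_assoc_pmf by (intro bind_pmf_cong) simp_all
  \<comment> \<open>Averaging over \<open>Suc T\<close> terms avoids a division by zero at
    \<open>T = 0\<close>.\<close>
  define a where "a T y = (\<Sum>k<Suc T. pmf (r k) y) / real (Suc T)" for T y
  have a_sum: "(\<Sum>y\<in>G. a T y) = (\<Sum>k<Suc T. measure_pmf.prob (r k) G) / real (Suc T)"
    if "finite G" for G T
    unfolding a_def sum_divide_distrib[symmetric]
    by (subst sum.swap) (simp add: measure_measure_pmf_finite[OF that])
  have a_sum_le: "(\<Sum>y\<in>G. a T y) \<le> 1" if "finite G" for G T
  proof -
    have "(\<Sum>k<Suc T. measure_pmf.prob (r k) G) \<le> (\<Sum>k<Suc T. 1)"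
      by (intro sum_mono) simp
    then show ?thesis unfolding a_sum[OF that] by (simp add: divide_le_eq)
  qed
  have a_nonneg: "0 \<le> a T y" for T y
    by (simp add: a_def sum_nonneg)
  \<comment> \<open>Applying \<open>U\<close> shifts the average by one time step: the term at time
    0 is lost and the one at time \<open>Suc T\<close> is gained, hence the error
    \<open>1 / real (Suc T)\<close>.\<close>
  have a_sub: "(\<Sum>z\<in>G. a T z * pmf (U z) y) \<le> a T y + 1 / real (Suc T)" if "finite G" for G T y
  proof -
    have "(\<Sum>z\<in>G. a T z * pmf (U z) y)
        = (\<Sum>k<Suc T. \<Sum>z\<in>G. pmf (r k) z * pmf (U z) y) / real (Suc T)"
      unfolding a_def
      by (subst sum.swap) (simp add: sum_divide_distrib sum_distrib_right distrib_right del: sum.lessThan_Suc)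
    also have "\<dots> \<le> (\<Sum>k<Suc T. pmf (r (Suc k)) y) / real (Suc T)"
      unfolding r_Suc by (intro divide_right_mono sum_mono pmf_bind_ge_sum that) simp
    also have "(\<Sum>k<Suc T. pmf (r (Suc k)) y) = (\<Sum>k<Suc (Suc T). pmf (r k) y) - pmf (r 0) y"
      by (subst (2) sum.lessThan_Suc_shift) simp
    also have "\<dots> \<le> (\<Sum>k<Suc T. pmf (r k) y) + 1"
      using pmf_le_1[of "r (Suc T)" y] pmf_nonneg[of "r 0" y]
      unfolding sum.lessThan_Suc[of _ "Suc T"] by linarith
    finally show ?thesis by (simp add: a_def add_divide_distrib divide_right_mono)
  qed
  \<comment> \<open>Tychonoff gives compactness for pointwise convergence; countability of the state
    type makes the product first countable, hence yields a convergent subsequence.\<close>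
  have "compact (PiE UNIV (\<lambda>_::'a. {0..1::real}))"
    by (subst compactin_euclidean_iff[symmetric], subst euclidean_product_topology[symmetric],
        subst compactin_PiE) (auto simp: compactin_euclidean_iff)
  then have "seq_compact (PiE UNIV (\<lambda>_::'a. {0..1::real}))"
    by (rule compact_imp_seq_compact)
  moreover have "\<forall>T. a T \<in> PiE UNIV (\<lambda>_. {0..1})"
    using a_nonneg a_sum_le[of "{y}" for y] by auto
  ultimately obtain v \<tau> where v: "strict_mono (\<tau> :: nat \<Rightarrow> nat)" "(a \<circ> \<tau>) \<longlonglongrightarrow> v"
    unfolding seq_compact_def by blast
  have lim: "(\<lambda>j. a (\<tau> j) y) \<longlonglongrightarrow> v y" for y
  proof -
    have "isCont (\<lambda>f::'a \<Rightarrow> real. f y) v"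
      using continuous_on_product_coordinates[of y] continuous_on_eq_continuous_at[OF open_UNIV] by blast
    from isCont_tendsto_compose[OF this v(2)] show ?thesis by (simp only: o_def)
  qed
  have v_nonneg: "0 \<le> v y" for y
    using a_nonneg by (intro LIMSEQ_le_const[OF lim]) auto
  have v_sum_le: "(\<Sum>y\<in>G. v y) \<le> 1" if "finite G" for G
    using a_sum_le[OF that] by (intro LIMSEQ_le_const2[OF tendsto_sum[OF lim]]) auto
  have v_K: "\<kappa> \<le> (\<Sum>y\<in>K. v y)"
  proof (intro LIMSEQ_le_const[OF tendsto_sum[OF lim]] exI allI impI)
    fix j
    have "\<kappa> * real (Suc (\<tau> j)) \<le> (\<Sum>k<Suc (\<tau> j). measure_pmf.prob (r k) K)"
      unfolding r_def by (rule mass)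
    then show "\<kappa> \<le> (\<Sum>y\<in>K. a (\<tau> j) y)"
      unfolding a_sum[OF \<open>finite K\<close>] by (simp add: pos_le_divide_eq)
  qed
  have v_sub: "(\<Sum>z\<in>G. v z * pmf (U z) y) \<le> v y" if "finite G" for G y
  proof (rule LIMSEQ_le)
    show "(\<lambda>j. \<Sum>z\<in>G. a (\<tau> j) z * pmf (U z) y) \<longlonglongrightarrow> (\<Sum>z\<in>G. v z * pmf (U z) y)"
      by (intro tendsto_intros lim)
    have "(\<lambda>j. 1 / real (Suc (\<tau> j))) \<longlonglongrightarrow> 0"
      using LIMSEQ_subseq_LIMSEQ[OF LIMSEQ_inverse_real_of_nat v(1)]
      by (simp add: o_def inverse_eq_divide)
    from tendsto_add[OF lim this]
    show "(\<lambda>j. a (\<tau> j) y + 1 / real (Suc (\<tau> j))) \<longlonglongrightarrow> v y" by simp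
    show "\<exists>N. \<forall>j\<ge>N. (\<Sum>z\<in>G. a (\<tau> j) z * pmf (U z) y) \<le> a (\<tau> j) y + 1 / real (Suc (\<tau> j))"
      using a_sub[OF that] by blast
  qed
  have v_S: "y \<in> S" if "v y \<noteq> 0" for y
  proof (rule ccontr)
    assume "y \<notin> S"
    then have "pmf (r k) y = 0" for k
      using supp[of k] by (subst pmf_eq_0_set_pmf) (auto simp only: r_def)
    then have "a T y = 0" for T
      by (simp add: a_def)
    then have "v y = 0" using LIMSEQ_unique[OF lim[of y], of 0] by simp
    with that show False by simp
  qed
  define m where "m = infsum v UNIV"
  have summable: "v summable_on UNIV"
    by (rule nonneg_bdd_above_summable_on) (use v_nonneg v_sum_le in \<open>auto intro!: bdd_aboveI2\<close>)
  have "\<kappa> \<le> m"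
    using order_trans[OF v_K finite_sum_le_infsum[OF summable \<open>finite K\<close> subset_UNIV v_nonneg]]
    unfolding m_def .
  then have "0 < m" using \<open>0 < \<kappa>\<close> by simp
  define \<nu> where "\<nu> = embed_pmf (\<lambda>y. v y / m)"
  have \<nu>: "pmf \<nu> y = v y / m" for y
    unfolding \<nu>_def
  proof (rule pmf_embed_pmf)
    show "0 \<le> v y / m" for y using v_nonneg \<open>0 < m\<close> by simp
    have "((\<lambda>y. v y / m) has_sum (m / m)) UNIV"
      using has_sum_infsum[OF summable] unfolding m_def by (intro has_sum_divide_const)
    then have *: "(\<lambda>y. v y / m) summable_on UNIV" "(\<Sum>\<^sub>\<infinity>y. v y / m) = 1"
      using \<open>0 < m\<close> by (auto dest: has_sum_imp_summable infsumI)
    then have abs: "Infinite_Set_Sum.abs_summable_on (\<lambda>y. v y / m) UNIV"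
      by (intro abs_summable_equivalent[THEN iffD1] summable_on_iff_abs_summable_on_real[THEN iffD1])
    have "(\<integral>\<^sup>+y. ennreal (v y / m) \<partial>count_space UNIV) = ennreal (infsetsum (\<lambda>y. v y / m) UNIV)"
      using v_nonneg \<open>0 < m\<close> by (intro nn_integral_conv_infsetsum abs) simp
    then show "(\<integral>\<^sup>+y. ennreal (v y / m) \<partial>count_space UNIV) = 1"
      unfolding infsetsum_infsum[OF abs] *(2) by simp
  qed
  have "bind_pmf \<nu> U = \<nu>"
  proof (rule pmf_eqI_le)
    fix y
    show "pmf (bind_pmf \<nu> U) y \<le> pmf \<nu> y"
    proof (rule field_le_epsilon)
      fix e :: real assume "0 < e"
      \<comment> \<open>Since \<open>v_sub\<close> concerns finite sets, the integral is cut at a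
        finite \<open>G\<close> that carries all but \<open>e\<close> of
        \<open>\<nu>\<close>.\<close>
      obtain G where G: "finite G" "1 - e \<le> measure_pmf.prob \<nu> G"
        using pmf_finite_approx[OF \<open>0 < e\<close>, of \<nu>] by blast
      have "pmf (bind_pmf \<nu> U) y \<le> (\<integral>z. indicator G z * pmf (U z) y + indicator (-G) z \<partial>measure_pmf \<nu>)"
        unfolding pmf_bind
        by (intro integral_pmf_mono integrable_pmf_bounded[where B = 2])
           (auto simp: order_trans[OF pmf_le_1] split: split_indicator)
      also have "\<dots> = (\<integral>z. indicator G z * pmf (U z) y \<partial>measure_pmf \<nu>) + measure_pmf.prob \<nu> (-G)"
        by (subst Bochner_Integration.integral_add)
           (auto intro!: integrable_pmf_bounded[where B = 1] simp: pmf_le_1 split: split_indicator)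
      also have "(\<integral>z. indicator G z * pmf (U z) y \<partial>measure_pmf \<nu>) = (\<Sum>z\<in>G. pmf (U z) y * pmf \<nu> z)"
        by (subst integral_measure_pmf_real[OF G(1)]) (auto split: split_indicator_asm)
      also have "\<dots> = (\<Sum>z\<in>G. v z * pmf (U z) y) / m"
        by (simp add: \<nu> sum_divide_distrib mult.commute)
      also have "\<dots> \<le> pmf \<nu> y"
        unfolding \<nu> using v_sub[OF G(1)] \<open>0 < m\<close> by (intro divide_right_mono) auto
      finally show "pmf (bind_pmf \<nu> U) y \<le> pmf \<nu> y + e"
        using G(2) by (simp add: prob_Compl_pmf)
    qed
  qed
  moreover have "set_pmf \<nu> \<subseteq> S"
    using v_S by (auto simp: set_pmf_iff \<nu>)
  ultimately show thesis by (rule that)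
qed

section \<open>Uniformization\<close>

definition out_rate :: "'a set \<Rightarrow> ('a \<Rightarrow> 'a \<Rightarrow> real) \<Rightarrow> 'a \<Rightarrow> real" where
  "out_rate S q x = (\<Sum>\<^sub>\<infinity>y\<in>S - {x}. q x y)"

text \<open>Under \<open>bounded_rates\<close> the weights form a law for \<open>x \<in> S\<close>.
  At other states nothing is known about the value of \<open>embed_pmf\<close>, so the results on it
  assume \<open>x \<in> S\<close>.\<close>

definition uniformized :: "'a set \<Rightarrow> ('a \<Rightarrow> 'a \<Rightarrow> real) \<Rightarrow> real \<Rightarrow> 'a \<Rightarrow> 'a pmf" where
  "uniformized S q c x =
     embed_pmf (\<lambda>y. if y = x then 1 - out_rate S q x / c else if y \<in> S then q x y / c else 0)"

locale bounded_rates =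
  fixes S :: "'a set" and q :: "'a \<Rightarrow> 'a \<Rightarrow> real" and c :: real
  assumes q_nonneg: "\<And>x y. x \<in> S \<Longrightarrow> y \<in> S \<Longrightarrow> x \<noteq> y \<Longrightarrow> 0 \<le> q x y"
    and q_finite: "\<And>x. x \<in> S \<Longrightarrow> finite {y \<in> S - {x}. q x y \<noteq> 0}"
    and out_rate_le: "\<And>x. x \<in> S \<Longrightarrow> out_rate S q x \<le> c"
    and c_pos: "0 < c"
begin

abbreviation "U \<equiv> uniformized S q c"

lemma out_rate_eq:
  assumes "x \<in> S"
  shows "out_rate S q x = (\<Sum>y | y \<in> S - {x} \<and> q x y \<noteq> 0. q x y)"
  unfolding out_rate_def using q_finite[OF assms]
  by (subst infsum_cong_neutral[where T = "{y \<in> S - {x}. q x y \<noteq> 0}" and g = "q x"]) auto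

lemma pmf_uniformized:
  assumes x: "x \<in> S"
  shows "pmf (U x) y =
    (if y = x then 1 - out_rate S q x / c else if y \<in> S then q x y / c else 0)"
  unfolding uniformized_def
proof (rule pmf_embed_pmf)
  let ?f = "\<lambda>y. if y = x then 1 - out_rate S q x / c else if y \<in> S then q x y / c else 0"
  let ?A = "{y \<in> S - {x}. q x y \<noteq> 0}"
  show nonneg: "0 \<le> ?f y" for y
    using x c_pos out_rate_le[OF x] q_nonneg by (auto simp: divide_le_eq)
  have "(\<integral>\<^sup>+y. ennreal (?f y) \<partial>count_space UNIV) = (\<Sum>y\<in>insert x ?A. ennreal (?f y))"
    using q_finite[OF x] by (intro nn_integral_count_space') auto
  also have "\<dots> = ennreal (\<Sum>y\<in>insert x ?A. ?f y)"
    using nonneg by (intro sum_ennreal) auto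
  also have "(\<Sum>y\<in>insert x ?A. ?f y) = 1 - out_rate S q x / c + (\<Sum>y\<in>?A. q x y / c)"
    using q_finite[OF x] by (subst sum.insert) (auto intro!: sum.cong)
  also have "\<dots> = 1"
    by (simp add: out_rate_eq[OF x] sum_divide_distrib)
  finally show "(\<integral>\<^sup>+y. ennreal (?f y) \<partial>count_space UNIV) = 1" by simp
qed

lemma set_uniformized:
  assumes "x \<in> S"
  shows "set_pmf (U x) \<subseteq> insert x {y \<in> S - {x}. q x y \<noteq> 0}"
  by (auto simp: set_pmf_iff pmf_uniformized[OF assms] split: if_splits)

lemma set_uniformized_subset: "x \<in> S \<Longrightarrow> set_pmf (U x) \<subseteq> S"
  using set_uniformized by blast

text \<open>The sum is the generator of \<open>q\<close> applied to \<open>g\<close>, so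
  \<open>U\<close> is the identity plus the generator divided by \<open>c\<close>. Finiteness of the
  set of targets makes this valid for unbounded \<open>g\<close> such as a coordinate.\<close>

lemma expectation_uniformized:
  assumes x: "x \<in> S"
  shows "(\<integral>y. g y \<partial>measure_pmf (U x))
    = g x + (\<Sum>y | y \<in> S - {x} \<and> q x y \<noteq> 0. q x y * (g y - g x)) / c"
proof -
  let ?A = "{y \<in> S - {x}. q x y \<noteq> 0}"
  have "(\<integral>y. g y \<partial>measure_pmf (U x)) = (\<Sum>y\<in>insert x ?A. g y * pmf (U x) y)"
    using set_uniformized[OF x] q_finite[OF x] by (intro integral_measure_pmf_real) auto
  also have "\<dots> = g x * (1 - out_rate S q x / c) + (\<Sum>y\<in>?A. g y * (q x y / c))"
    using q_finite[OF x] by (subst sum.insert) (auto simp: pmf_uniformized[OF x] intro!: sum.cong)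
  also have "\<dots> = g x + (\<Sum>y\<in>?A. q x y * (g y - g x)) / c"
    by (simp add: out_rate_eq[OF x] right_diff_distrib sum_subtractf sum_divide_distrib
        sum_distrib_left algebra_simps diff_divide_distrib)
  finally show ?thesis .
qed

end

section \<open>Comparison of a semigroup with its uniformized kernel\<close>

lemma right_derivative_seq:
  fixes f :: "real \<Rightarrow> real"
  assumes "(f has_real_derivative D) (at_right 0)" "0 < t"
  shows "(\<lambda>k. real (Suc k) * (f (t / real (Suc k)) - f 0)) \<longlonglongrightarrow> t * D"
proof -
  have "((\<lambda>h. (f h - f 0) / (h - 0)) \<longlongrightarrow> D) (at_right 0)"
    using assms(1) by (simp add: has_field_derivative_iff)
  moreover have "filterlim (\<lambda>k. t / real (Suc k)) (at_right 0) sequentially"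
  proof (rule filterlim_at_withinI)
    show "(\<lambda>k. t / real (Suc k)) \<longlonglongrightarrow> 0"
      using tendsto_mult_right[OF LIMSEQ_inverse_real_of_nat, of t] by (simp add: field_simps)
  qed (use \<open>0 < t\<close> in auto)
  ultimately have "(\<lambda>k. (f (t / real (Suc k)) - f 0) / (t / real (Suc k))) \<longlonglongrightarrow> D"
    by (auto dest: filterlim_compose)
  from tendsto_mult_left[OF this, of t] show ?thesis
    using \<open>0 < t\<close> by (simp add: mult.commute)
qed

context bounded_rates
begin

context
  fixes p :: "real \<Rightarrow> 'a \<Rightarrow> 'a pmf"
  assumes semigroup: "transition_semigroup S q p"
begin

lemma set_semigroup: "0 \<le> t \<Longrightarrow> x \<in> S \<Longrightarrow> set_pmf (p t x) \<subseteq> S"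
  using semigroup unfolding transition_semigroup_def by blast

lemma semigroup_0: "x \<in> S \<Longrightarrow> p 0 x = return_pmf x"
  using semigroup unfolding transition_semigroup_def by blast

lemma semigroup_add: "0 \<le> s \<Longrightarrow> 0 \<le> t \<Longrightarrow> x \<in> S \<Longrightarrow> p (s + t) x = bind_pmf (p s x) (p t)"
  using semigroup unfolding transition_semigroup_def by blast

text \<open>Being at \<open>x\<close> at all \<open>Suc k\<close> grid points is one way of being
  there at time \<open>t\<close>. Bernoulli's inequality linearizes the resulting power, and letting
  \<open>k\<close> grow brings in the diagonal derivative at 0, so that a derivative at 0 becomes a
  bound for every \<open>t\<close>.\<close>

lemma semigroup_stay_ge:
  assumes x: "x \<in> S" and "0 \<le> t"
  shows "1 - t * out_rate S q x \<le> pmf (p t x) x"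
proof (cases "t = 0")
  case False
  with \<open>0 \<le> t\<close> have "0 < t" by simp
  let ?b = "\<lambda>k. pmf (p (t / real (Suc k)) x) x"
  have pow: "pmf (p \<delta> x) x ^ k \<le> pmf (p (real k * \<delta>) x) x" if "0 \<le> \<delta>" for \<delta> k
  proof (induction k)
    case (Suc k)
    have "pmf (p \<delta> x) x ^ Suc k \<le> pmf (p \<delta> x) x * pmf (p (real k * \<delta>) x) x"
      using Suc by (simp add: mult_left_mono)
    also have "\<dots> \<le> pmf (bind_pmf (p \<delta> x) (p (real k * \<delta>))) x"
      by (rule pmf_bind_ge)
    also have "bind_pmf (p \<delta> x) (p (real k * \<delta>)) = p (real (Suc k) * \<delta>) x"
      using semigroup_add[of \<delta> "real k * \<delta>" x] x that by (simp add: algebra_simps)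
    finally show ?case .
  qed (use x in \<open>simp add: semigroup_0\<close>)
  have "1 + real (Suc k) * (?b k - pmf (p 0 x) x) \<le> pmf (p t x) x" for k
  proof -
    have "1 + real (Suc k) * (?b k - 1) \<le> (1 + (?b k - 1)) ^ Suc k"
      by (rule Bernoulli_inequality) (simp add: add_increasing)
    also have "\<dots> \<le> pmf (p t x) x"
      using pow[of "t / real (Suc k)" "Suc k"] \<open>0 < t\<close> by simp
    finally show ?thesis using x by (simp add: semigroup_0)
  qed
  moreover have "(\<lambda>k. 1 + real (Suc k) * (?b k - pmf (p 0 x) x))
      \<longlonglongrightarrow> 1 + t * (- out_rate S q x)"
    using semigroup x \<open>0 < t\<close>
    by (intro tendsto_add tendsto_const right_derivative_seq)
       (auto simp: transition_semigroup_def out_rate_def)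
  ultimately have "1 + t * (- out_rate S q x) \<le> pmf (p t x) x"
    by (intro LIMSEQ_le_const2) auto
  then show ?thesis by simp
qed (use x in \<open>simp add: semigroup_0\<close>)

text \<open>Only those grid paths are counted that stay at \<open>x\<close>, jump once to
  \<open>y\<close> and stay there. With \<open>k\<close> grid steps there are \<open>k\<close>
  places for the jump, and the two stays together cost at most the factor
  \<open>1 - c * t\<close>.\<close>

lemma semigroup_jump_ge:
  assumes x: "x \<in> S" and y: "y \<in> S" and "x \<noteq> y" and "0 \<le> t"
  shows "t * q x y * (1 - c * t) \<le> pmf (p t x) y"
proof (cases "t = 0 \<or> 1 < c * t")
  \<comment> \<open>Here the left side is not positive, so the bound is trivial.\<close>
  case True
  have "t * q x y * (1 - c * t) \<le> 0"
    using True q_nonneg[OF x y \<open>x \<noteq> y\<close>] \<open>0 \<le> t\<close>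
    by (cases "t = 0") (auto intro!: mult_nonneg_nonpos)
  then show ?thesis by (rule order_trans) simp
next
  case False
  with \<open>0 \<le> t\<close> have "0 < t" "c * t \<le> 1" by auto
  have stay: "1 - c * s \<le> pmf (p s z) z" if "z \<in> S" "0 \<le> s" for z s
    using semigroup_stay_ge[OF that] mult_left_mono[OF out_rate_le[OF that(1)] that(2)]
    by (simp add: mult.commute)
  have claim: "real k * pmf (p \<delta> x) y * (1 - c * (real k * \<delta>)) \<le> pmf (p (real k * \<delta>) x) y"
    if "0 \<le> \<delta>" "c * (real k * \<delta>) \<le> 1" for \<delta> k
    using that(2)
  proof (induction k)
    case (Suc k)
    define b a where "b = pmf (p \<delta> x) y" and "a = c * (real k * \<delta>)"
    have c\<delta>: "0 \<le> c * \<delta>" "0 \<le> a" "a + c * \<delta> \<le> 1"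
      using c_pos that(1) Suc.prems by (auto simp: a_def algebra_simps)
    have "b \<ge> 0" by (simp add: b_def)
    \<comment> \<open>The right side exceeds the left by
      \<open>real k * b * (a * (c * \<delta>)) + b * (c * \<delta>)\<close>. Its two summands stand
      for a first grid step that stays at \<open>x\<close> and one that jumps to
      \<open>y\<close>.\<close>
    have "real (Suc k) * b * (1 - (a + c * \<delta>))
        \<le> (1 - c * \<delta>) * (real k * b * (1 - a)) + b * (1 - a)"
    proof -
      have "0 \<le> real k * b * (a * (c * \<delta>)) + b * (c * \<delta>)"
        using \<open>0 \<le> b\<close> c\<delta> by simp
      then show ?thesis by (simp add: algebra_simps)
    qed
    also have "\<dots> \<le> pmf (p \<delta> x) x * pmf (p (real k * \<delta>) x) y + pmf (p \<delta> x) y * pmf (p (real k * \<delta>) y) y"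
    proof (intro add_mono mult_mono)
      show "real k * b * (1 - a) \<le> pmf (p (real k * \<delta>) x) y"
        using Suc c\<delta> by (simp add: a_def b_def)
      show "1 - a \<le> pmf (p (real k * \<delta>) y) y"
        using stay[OF y, of "real k * \<delta>"] that(1) by (simp add: a_def)
    qed (use stay[OF x that(1)] \<open>0 \<le> b\<close> c\<delta> in \<open>auto simp: b_def\<close>)
    also have "\<dots> \<le> pmf (bind_pmf (p \<delta> x) (p (real k * \<delta>))) y"
      using \<open>x \<noteq> y\<close> by (rule pmf_bind_ge2)
    also have "bind_pmf (p \<delta> x) (p (real k * \<delta>)) = p (real (Suc k) * \<delta>) x"
      using semigroup_add[of \<delta> "real k * \<delta>" x] x that(1) by (simp add: algebra_simps)
    finally show ?case by (simp add: a_def b_def algebra_simps)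
  qed simp
  have "(\<lambda>k. real (Suc k) * (pmf (p (t / real (Suc k)) x) y - pmf (p 0 x) y)) \<longlonglongrightarrow> t * q x y"
    using semigroup x y \<open>x \<noteq> y\<close> \<open>0 < t\<close>
    by (intro right_derivative_seq) (auto simp: transition_semigroup_def)
  then have "(\<lambda>k. real (Suc k) * pmf (p (t / real (Suc k)) x) y * (1 - c * t))
      \<longlonglongrightarrow> t * q x y * (1 - c * t)"
    using x \<open>x \<noteq> y\<close> by (intro tendsto_mult_right) (simp add: semigroup_0)
  moreover have "real (Suc k) * pmf (p (t / real (Suc k)) x) y * (1 - c * t) \<le> pmf (p t x) y" for k
    using claim[of "t / real (Suc k)" "Suc k"] \<open>0 < t\<close> \<open>c * t \<le> 1\<close> by simp
  ultimately show ?thesis by (intro LIMSEQ_le_const2) auto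
qed

text \<open>Off the diagonal this is \<open>semigroup_jump_ge\<close>, whose factor
  \<open>1 - c * h\<close> dictates the weight of \<open>U\<close>. On the diagonal that factor is
  bounded by 1, and what remains is \<open>1 - h * out_rate S q x\<close>.\<close>

lemma semigroup_ge_uniformized:
  assumes x: "x \<in> S" and h: "0 \<le> h" "c * h \<le> 1"
  shows "(1 - c * h) * indicator {x} y + c * h * (1 - c * h) * pmf (U x) y \<le> pmf (p h x) y"
proof (cases "y = x")
  case True
  have "(1 - c * h) * (c * h) * pmf (U x) x \<le> 1 * (c * h) * pmf (U x) x"
    using h c_pos by (intro mult_right_mono) auto
  also have "\<dots> = c * h - h * out_rate S q x"
    using c_pos by (simp add: pmf_uniformized[OF x] algebra_simps)
  finally show ?thesis
    using True semigroup_stay_ge[OF x h(1)] by (simp add: mult_ac)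
next
  case False
  then show ?thesis
    using semigroup_jump_ge[OF x _ _ h(1), of y] c_pos
    by (auto simp: pmf_uniformized[OF x] mult_ac)
qed

lemma expectation_semigroup_ge_uniformized:
  fixes f :: "'a \<Rightarrow> real"
  assumes x: "x \<in> S" and h: "0 \<le> h" "c * h \<le> 1" and f: "\<And>y. 0 \<le> f y" "\<And>y. f y \<le> 1"
  shows "(1 - c * h) * f x + c * h * (1 - c * h) * (\<integral>y. f y \<partial>measure_pmf (U x))
    \<le> (\<integral>y. f y \<partial>measure_pmf (p h x))"
proof -
  define A where "A = insert x {y \<in> S - {x}. q x y \<noteq> 0}"
  have A: "finite A" "set_pmf (U x) \<subseteq> A" "x \<in> A"
    using q_finite[OF x] set_uniformized[OF x] by (auto simp: A_def)
  have "(1 - c * h) * f x + c * h * (1 - c * h) * (\<integral>y. f y \<partial>measure_pmf (U x))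
      = (\<Sum>y\<in>A. f y * ((1 - c * h) * indicator {x} y + c * h * (1 - c * h) * pmf (U x) y))"
  proof -
    have "(\<Sum>y\<in>A. f y * ((1 - c * h) * indicator {x} y)) = (\<Sum>y\<in>A. if y = x then (1 - c * h) * f x else 0)"
      by (intro sum.cong) auto
    also have "\<dots> = (1 - c * h) * f x"
      using A by simp
    finally show ?thesis
      using A by (subst integral_measure_pmf_real[of A])
        (auto simp: distrib_left sum.distrib sum_distrib_left mult_ac)
  qed
  also have "\<dots> \<le> (\<Sum>y\<in>A. f y * pmf (p h x) y)"
    by (intro sum_mono mult_left_mono semigroup_ge_uniformized x h f)
  also have "\<dots> = (\<integral>y. indicator A y * f y \<partial>measure_pmf (p h x))"
    by (subst integral_measure_pmf_real[OF A(1)]) (auto split: split_indicator_asm)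
  also have "\<dots> \<le> (\<integral>y. f y \<partial>measure_pmf (p h x))"
    using f by (intro integral_pmf_mono integrable_pmf_bounded[where B = 1]) (auto split: split_indicator)
  finally show ?thesis .
qed

text \<open>In the lower bound, one time step of length \<open>h\<close> either keeps the power of
  \<open>U\<close> or raises it by one, so the induction over time steps has to treat all powers
  \<open>k\<close> at once. With \<open>Suc m\<close> steps of length \<open>t / Suc m\<close>,
  Bernoulli's inequality bounds the relative loss by \<open>(c * t)^2 / Suc m\<close>, which
  vanishes as \<open>m\<close> grows.\<close>

theorem prob_semigroup_ge:
  assumes \<mu>: "set_pmf \<mu> \<subseteq> S" and "0 \<le> a" "0 \<le> t"
    and ge: "\<And>k. a \<le> measure_pmf.prob (bind_pmf \<mu> (kernel_pow U k)) K"
  shows "a \<le> measure_pmf.prob (bind_pmf \<mu> (p t)) K"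
proof -
  have step: "(1 - (c * h)\<^sup>2) ^ j * a \<le>
      measure_pmf.prob (bind_pmf (bind_pmf \<mu> (p (real j * h))) (kernel_pow U k)) K"
    if h: "0 \<le> h" "c * h \<le> 1" for h j k
  proof (induction j arbitrary: k)
    case 0
    have "bind_pmf \<mu> (p 0) = \<mu>"
      using bind_pmf_cong[OF refl, of \<mu> "p 0" return_pmf] \<mu> semigroup_0 bind_return_pmf'[of \<mu>] by auto
    then show ?case using ge by simp
  next
    case (Suc j)
    define \<theta> where "\<theta> = c * h"
    have \<theta>: "0 \<le> \<theta>" "\<theta> \<le> 1" using h c_pos by (auto simp: \<theta>_def)
    define \<sigma> where "\<sigma> = bind_pmf \<mu> (p (real j * h))"
    have \<sigma>: "set_pmf \<sigma> \<subseteq> S" using \<mu> h(1) set_semigroup[of "real j * h"] by (auto simp: \<sigma>_def)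
    let ?f = "\<lambda>k z. measure_pmf.prob (kernel_pow U k z) K"
    have "bind_pmf \<mu> (p (real (Suc j) * h)) = bind_pmf \<sigma> (p h)"
      unfolding \<sigma>_def bind_assoc_pmf
      using \<mu> h(1) semigroup_add[of "real j * h" h]
      by (intro bind_pmf_cong refl) (auto simp: algebra_simps)
    then have "measure_pmf.prob (bind_pmf (bind_pmf \<mu> (p (real (Suc j) * h))) (kernel_pow U k)) K
        = (\<integral>x. (\<integral>z. ?f k z \<partial>measure_pmf (p h x)) \<partial>measure_pmf \<sigma>)"
      by (simp add: bind_assoc_pmf measure_bind_pmf)
    moreover have "(1 - \<theta>) * measure_pmf.prob (bind_pmf \<sigma> (kernel_pow U k)) K
          + \<theta> * (1 - \<theta>) * measure_pmf.prob (bind_pmf \<sigma> (kernel_pow U (Suc k))) K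
        = (\<integral>x. (1 - \<theta>) * ?f k x + \<theta> * (1 - \<theta>) * ?f (Suc k) x \<partial>measure_pmf \<sigma>)"
      by (subst Bochner_Integration.integral_add)
         (auto simp: measure_bind_pmf simp del: kernel_pow.simps
           intro!: integrable_mult_right integrable_pmf_bounded[where B = 1])
    moreover have "\<dots> \<le> (\<integral>x. (\<integral>z. ?f k z \<partial>measure_pmf (p h x)) \<partial>measure_pmf \<sigma>)"
    proof (intro integral_pmf_mono)
      show "integrable (measure_pmf \<sigma>) (\<lambda>x. \<integral>z. ?f k z \<partial>measure_pmf (p h x))"
        by (rule integrable_pmf_bounded[where B = 1]) (simp flip: measure_bind_pmf)
      show "(1 - \<theta>) * ?f k x + \<theta> * (1 - \<theta>) * ?f (Suc k) x \<le> (\<integral>z. ?f k z \<partial>measure_pmf (p h x))"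
        if "x \<in> set_pmf \<sigma>" for x
        using expectation_semigroup_ge_uniformized[of x h "?f k"] that \<sigma> h
        by (auto simp: kernel_pow_Suc_left measure_bind_pmf \<theta>_def simp del: kernel_pow.simps)
    qed (intro Bochner_Integration.integrable_add integrable_mult_right
        integrable_pmf_bounded[where B = 1], simp_all del: kernel_pow.simps)
    moreover have "(1 - \<theta>\<^sup>2) ^ Suc j * a = (1 - \<theta>) * ((1 - \<theta>\<^sup>2) ^ j * a) + \<theta> * (1 - \<theta>) * ((1 - \<theta>\<^sup>2) ^ j * a)"
      by (simp add: algebra_simps power2_eq_square)
    moreover have "\<dots> \<le> (1 - \<theta>) * measure_pmf.prob (bind_pmf \<sigma> (kernel_pow U k)) K
          + \<theta> * (1 - \<theta>) * measure_pmf.prob (bind_pmf \<sigma> (kernel_pow U (Suc k))) K"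
      using Suc.IH \<theta> unfolding \<sigma>_def \<theta>_def
      by (intro add_mono mult_left_mono) (auto simp del: kernel_pow.simps)
    ultimately show ?case by (simp add: \<theta>_def)
  qed
  have "a - a * (c * t)\<^sup>2 * (1 / real (Suc m)) \<le> measure_pmf.prob (bind_pmf \<mu> (p t)) K"
    if m: "c * t \<le> real (Suc m)" for m
  proof -
    define h where "h = t / real (Suc m)"
    have h: "0 \<le> h" "c * h \<le> 1" using m \<open>0 \<le> t\<close> by (auto simp: h_def)
    then have "(c * h)\<^sup>2 \<le> 1" using c_pos by (intro power_le_one) auto
    have "1 + real (Suc m) * (- (c * h)\<^sup>2) \<le> (1 + (- (c * h)\<^sup>2)) ^ Suc m"
      using \<open>(c * h)\<^sup>2 \<le> 1\<close> by (intro Bernoulli_inequality) simp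
    then have "(1 - real (Suc m) * (c * h)\<^sup>2) * a \<le> (1 - (c * h)\<^sup>2) ^ Suc m * a"
      using \<open>0 \<le> a\<close> by (intro mult_right_mono) auto
    also have "\<dots> \<le> measure_pmf.prob (bind_pmf (bind_pmf \<mu> (p (real (Suc m) * h))) (kernel_pow U 0)) K"
      by (rule step[OF h])
    also have "bind_pmf (bind_pmf \<mu> (p (real (Suc m) * h))) (kernel_pow U 0) = bind_pmf \<mu> (p t)"
      by (simp add: h_def bind_return_pmf' cong: bind_pmf_cong)
    also have "real (Suc m) * (c * h)\<^sup>2 = (c * t)\<^sup>2 * (1 / real (Suc m))"
      by (simp add: h_def power2_eq_square)
    finally show ?thesis by (simp add: algebra_simps)
  qed
  moreover have "(\<lambda>m. a - a * (c * t)\<^sup>2 * (1 / real (Suc m))) \<longlonglongrightarrow> a - a * (c * t)\<^sup>2 * 0"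
    using LIMSEQ_inverse_real_of_nat by (intro tendsto_intros) (simp add: inverse_eq_divide)
  moreover have "\<forall>\<^sub>F m in sequentially. c * t \<le> real (Suc m)"
    using eventually_ge_at_top[of "nat \<lceil>c * t\<rceil>"] by eventually_elim linarith
  ultimately have "a - a * (c * t)\<^sup>2 * 0 \<le> measure_pmf.prob (bind_pmf \<mu> (p t)) K"
    by (intro tendsto_upperbound) (auto elim: eventually_mono)
  then show ?thesis by simp
qed

text \<open>Integrating \<open>semigroup_ge_uniformized\<close> against \<open>\<pi>\<close> bounds
  \<open>\<pi>\<close> below by \<open>(1 - c h) \<pi> + c h (1 - c h) \<pi> U\<close>. Cancelling,
  dividing by \<open>c h\<close> and letting \<open>h\<close> tend to 0 leaves
  \<open>\<pi> U \<le> \<pi>\<close>.\<close>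

theorem stationary_uniformized:
  assumes \<pi>: "set_pmf \<pi> \<subseteq> S" and stat: "\<And>t. 0 \<le> t \<Longrightarrow> bind_pmf \<pi> (p t) = \<pi>"
  shows "bind_pmf \<pi> U = \<pi>"
proof (rule pmf_eqI_le)
  fix y
  have ineq: "(1 - c * h) * pmf (bind_pmf \<pi> U) y \<le> pmf \<pi> y" if h: "0 < h" "c * h \<le> 1" for h
  proof -
    have return: "indicat_real {x} y = indicator {y} x" for x
      by (auto simp: indicator_def)
    have "(1 - c * h) * pmf \<pi> y + c * h * (1 - c * h) * pmf (bind_pmf \<pi> U) y
        = (1 - c * h) * pmf (bind_pmf \<pi> return_pmf) y + c * h * (1 - c * h) * pmf (bind_pmf \<pi> U) y"
      by (simp add: bind_return_pmf')
    also have "\<dots> = (\<integral>x. (1 - c * h) * indicator {x} y + c * h * (1 - c * h) * pmf (U x) y \<partial>measure_pmf \<pi>)"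
      unfolding pmf_bind
      by (subst Bochner_Integration.integral_add)
         (auto intro!: integrable_mult_right integrable_pmf_bounded[where B = 1]
           simp: pmf_le_1 return)
    also have "\<dots> \<le> (\<integral>x. pmf (p h x) y \<partial>measure_pmf \<pi>)"
      using \<pi> h
      by (intro integral_pmf_mono Bochner_Integration.integrable_add integrable_mult_right
           integrable_pmf_bounded[where B = 1] semigroup_ge_uniformized)
         (auto simp: pmf_le_1 indicator_def)
    also have "\<dots> = pmf \<pi> y"
      using stat[of h] h by (simp flip: pmf_bind)
    finally have "(c * h) * ((1 - c * h) * pmf (bind_pmf \<pi> U) y) \<le> (c * h) * pmf \<pi> y"
      by (simp add: algebra_simps)
    then show ?thesis using c_pos h by (simp add: mult_le_cancel_left_pos)
  qed
  have "((\<lambda>h. (1 - c * h) * pmf (bind_pmf \<pi> U) y) \<longlongrightarrow> (1 - c * 0) * pmf (bind_pmf \<pi> U) y) (at_right 0)"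
    by (intro tendsto_intros)
  moreover have "\<forall>\<^sub>F h in at_right 0. (1 - c * h) * pmf (bind_pmf \<pi> U) y \<le> pmf \<pi> y"
  proof (rule eventually_mono[OF eventually_at_right_real[of 0 "1 / c"]])
    show "(1 - c * h) * pmf (bind_pmf \<pi> U) y \<le> pmf \<pi> y" if "h \<in> {0<..<1 / c}" for h
      using that c_pos by (intro ineq) (auto simp: pos_less_divide_eq mult.commute)
  qed (use c_pos in simp)
  ultimately have "(1 - c * 0) * pmf (bind_pmf \<pi> U) y \<le> pmf \<pi> y"
    by (intro tendsto_upperbound[of _ _ "at_right (0::real)"]) auto
  then show "pmf (bind_pmf \<pi> U) y \<le> pmf \<pi> y" by simp
qed

end

end

section \<open>Birth and death rates\<close>

lemma in_states [simp]: "x \<in> states N \<longleftrightarrow> length x = N"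
  by (simp add: states_def)

lemma list_update_up_neq: "i < length x \<Longrightarrow> x[i := Suc (x ! i)] \<noteq> x"
  by (metis n_not_Suc_n nth_list_update_eq)

text \<open>\<open>sum_le\<close> is an inequality so that the constants \<open>B\<close> and
  \<open>c\<close> chosen for n+1 classes also serve the first n. For \<open>N = 0\<close> the sum
  is empty, so positivity of \<open>c\<close> is assumed separately.\<close>

locale birth_death =
  fixes N :: nat and lam :: "nat \<Rightarrow> real" and phi :: "nat \<Rightarrow> nat list \<Rightarrow> real" and B c :: real
  assumes lam_pos: "\<And>i. i < N \<Longrightarrow> 0 < lam i"
    and phi_nonneg: "\<And>i x. i < N \<Longrightarrow> length x = N \<Longrightarrow> 0 \<le> phi i x"
    and phi_le: "\<And>i x. i < N \<Longrightarrow> length x = N \<Longrightarrow> phi i x \<le> B"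
    and sum_le: "(\<Sum>i<N. lam i + B) \<le> c"
    and c_pos: "0 < c"
begin

abbreviation "q \<equiv> birth_death_rate N lam phi"

text \<open>A finite superset of the possible targets: truncated subtraction puts \<open>x\<close>
  itself into it when a coordinate is 0. In \<open>sum_off_diagonal\<close> the condition
  \<open>g x = 0\<close> makes this harmless.\<close>

definition neighbours :: "nat list \<Rightarrow> nat list set" where
  "neighbours x = (\<lambda>i. x[i := x ! i + 1]) ` {..<N} \<union> (\<lambda>i. x[i := x ! i - 1]) ` {..<N}"

lemma finite_neighbours: "finite (neighbours x)"
  by (simp add: neighbours_def)

lemma rate_eq_0: "y \<notin> neighbours x \<Longrightarrow> q x y = 0"
  unfolding birth_death_rate_def neighbours_def by (intro sum.neutral) auto

text \<open>Summing by transition instead of by target removes the question whether two transitions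
  share a target.\<close>

lemma sum_rate:
  "(\<Sum>y\<in>neighbours x. q x y * g y) =
     (\<Sum>i<N. lam i * g (x[i := x ! i + 1]) + (if 0 < x ! i then phi i x * g (x[i := x ! i - 1]) else 0))"
proof -
  have "(\<Sum>y\<in>neighbours x. q x y * g y)
      = (\<Sum>i<N. \<Sum>y\<in>neighbours x. (if y = x[i := x ! i + 1] then lam i * g y else 0)
          + (if y = x[i := x ! i - 1] then if 0 < x ! i then phi i x * g y else 0 else 0))"
    unfolding birth_death_rate_def sum_distrib_right
    by (subst sum.swap) (intro sum.cong refl, auto simp: distrib_right)
  also have "\<dots> = (\<Sum>i<N. lam i * g (x[i := x ! i + 1])
      + (if 0 < x ! i then phi i x * g (x[i := x ! i - 1]) else 0))"
    unfolding sum.distrib using finite_neighbours[of x]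
    by (intro arg_cong2[where f = "(+)"] sum.cong refl) (auto simp: sum.delta neighbours_def)
  finally show ?thesis .
qed

lemma rate_ge_lam:
  assumes "i < N" "length x = N"
  shows "lam i \<le> q x (x[i := x ! i + 1])"
proof -
  let ?y = "x[i := x ! i + 1]"
  let ?t = "\<lambda>j. (if ?y = x[j := x ! j + 1] then lam j else 0)
      + (if 0 < x ! j \<and> ?y = x[j := x ! j - 1] then phi j x else 0)"
  have "0 \<le> ?t j" if "j < N" for j
    using lam_pos[OF that] phi_nonneg[OF that assms(2)] by simp
  then have "?t i \<le> (\<Sum>j<N. ?t j)"
    using assms(1) by (intro member_le_sum) auto
  moreover have "lam i \<le> ?t i"
    using phi_nonneg[OF assms] by simp
  ultimately show ?thesis unfolding birth_death_rate_def by linarith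
qed

lemma rate_nonneg: "length x = N \<Longrightarrow> 0 \<le> q x y"
  unfolding birth_death_rate_def using lam_pos phi_nonneg
  by (intro sum_nonneg add_nonneg_nonneg) (auto simp: less_imp_le)

lemma neighbours_subset: "length x = N \<Longrightarrow> neighbours x \<subseteq> states N"
  by (auto simp: neighbours_def)

lemma sum_off_diagonal:
  assumes "length x = N" "g x = 0"
  shows "(\<Sum>y | y \<in> states N - {x} \<and> q x y \<noteq> 0. q x y * g y) = (\<Sum>y\<in>neighbours x. q x y * g y)"
  using finite_neighbours neighbours_subset[OF assms(1)] rate_eq_0 assms(2)
  by (intro sum.mono_neutral_left) auto

sublocale bounded_rates "states N" q c
proof
  fix x assume "x \<in> states N"
  then have x: "length x = N" by simp
  show fin: "finite {y \<in> states N - {x}. q x y \<noteq> 0}"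
    by (rule finite_subset[OF _ finite_neighbours[of x]]) (use rate_eq_0 in auto)
  \<comment> \<open>The test function \<open>of_bool (y \<noteq> x)\<close> vanishes at
    \<open>x\<close>, which brings the total rate under \<open>sum_off_diagonal\<close> and
    \<open>sum_rate\<close>.\<close>
  have "out_rate (states N) q x = (\<Sum>y | y \<in> states N - {x} \<and> q x y \<noteq> 0. q x y * of_bool (y \<noteq> x))"
    unfolding out_rate_def using fin
    by (subst infsum_cong_neutral[where T = "{y \<in> states N - {x}. q x y \<noteq> 0}" and g = "q x"]) auto
  also have "\<dots> = (\<Sum>y\<in>neighbours x. q x y * of_bool (y \<noteq> x))"
    using x by (intro sum_off_diagonal) auto
  also have "\<dots> \<le> (\<Sum>i<N. lam i + B)"
    unfolding sum_rate
  proof (intro sum_mono add_mono)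
    fix i assume "i \<in> {..<N}"
    then have i: "i < N" by simp
    show "lam i * of_bool (x[i := x ! i + 1] \<noteq> x) \<le> lam i"
      using lam_pos[OF i] by simp
    show "(if 0 < x ! i then phi i x * of_bool (x[i := x ! i - 1] \<noteq> x) else 0) \<le> B"
      using phi_nonneg[OF i x] phi_le[OF i x] by (auto intro: order_trans)
  qed
  also have "\<dots> \<le> c" by (rule sum_le)
  finally show "out_rate (states N) q x \<le> c" .
qed (use rate_nonneg c_pos in auto)

lemma expectation_uniformized_birth_death:
  assumes x: "length x = N"
  shows "(\<integral>y. g y \<partial>measure_pmf (U x)) = g x + (\<Sum>i<N. lam i * (g (x[i := x ! i + 1]) - g x)
      + (if 0 < x ! i then phi i x * (g (x[i := x ! i - 1]) - g x) else 0)) / c"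
proof -
  have "x \<in> states N" using x by simp
  then show ?thesis
    by (simp only: expectation_uniformized sum_off_diagonal[OF x, of "\<lambda>y. g y - g x"] diff_self sum_rate)
qed

lemma pmf_uniformized_up_ge:
  assumes "i < N" "length x = N"
  shows "lam i / c \<le> pmf (U x) (x[i := x ! i + 1])"
  using rate_ge_lam[OF assms] list_update_up_neq[of i x] assms c_pos
  by (simp add: pmf_uniformized divide_right_mono)

text \<open>The births in \<open>r\<close> are performed one at a time, each with probability at
  least \<open>lam i / c\<close> wherever the chain stands. Hence \<open>d\<close> and
  \<open>\<delta>\<close> can be chosen before \<open>x\<close>, as
  \<open>tight_orbit_if_reaches_stationary_support\<close> requires.\<close>

lemma kernel_pow_reaches_sum:
  assumes "length r = N"
  shows "\<exists>d \<delta>. 0 < \<delta> \<and> (\<forall>x. length x = N \<longrightarrow> \<delta> \<le> pmf (kernel_pow U d x) (map2 (+) x r))"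
  using assms
proof (induction "sum_list r" arbitrary: r)
  case 0
  then have "map2 (+) x r = x" if "length x = N" for x
    using that by (intro nth_equalityI) auto
  then show ?case by (intro exI[of _ 0] exI[of _ 1]) auto
next
  case (Suc s)
  then obtain i where i: "i < N" "0 < r ! i"
    by (metis Suc_neq_Zero gr0I in_set_conv_nth sum_list_eq_0_iff)
  define r' where "r' = r[i := r ! i - 1]"
  have "sum_list r' = s" "length r' = N"
    using Suc.prems Suc.hyps(2) i elem_le_sum_list[of i r] by (auto simp: r'_def sum_list_update)
  with Suc.hyps(1)[of r'] obtain d \<delta> where \<delta>: "0 < \<delta>"
    "\<And>x. length x = N \<Longrightarrow> \<delta> \<le> pmf (kernel_pow U d x) (map2 (+) x r')" by metis
  have "\<delta> * (lam i / c) \<le> pmf (kernel_pow U (Suc d) x) (map2 (+) x r)" if x: "length x = N" for x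
  proof -
    define y where "y = map2 (+) x r'"
    have y: "length y = N" "map2 (+) x r = y[i := y ! i + 1]"
      using x \<open>length r' = N\<close> Suc.prems i
      by (auto simp: y_def r'_def nth_list_update intro!: nth_equalityI)
    have "\<delta> * (lam i / c) \<le> pmf (kernel_pow U d x) y * pmf (U y) (y[i := y ! i + 1])"
      using \<delta> x pmf_uniformized_up_ge[OF i(1) y(1)] lam_pos[OF i(1)] c_pos
      by (intro mult_mono) (auto simp: y_def)
    also have "\<dots> \<le> pmf (kernel_pow U (Suc d) x) (map2 (+) x r)"
      unfolding y(2) kernel_pow.simps by (rule pmf_bind_ge)
    finally show ?thesis .
  qed
  moreover have "0 < \<delta> * (lam i / c)" using \<delta> lam_pos[OF i(1)] c_pos by simp
  ultimately show ?case by blast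
qed

theorem tight_orbit_birth_death:
  assumes stat: "bind_pmf \<nu> U = \<nu>" and \<nu>: "set_pmf \<nu> \<subseteq> states N" and \<mu>: "set_pmf \<mu> \<subseteq> states N"
  shows "tight_orbit U \<mu>"
proof -
  obtain r where r: "r \<in> set_pmf \<nu>" "length r = N"
    using \<nu> set_pmf_not_empty[of \<nu>] by fastforce
  obtain d \<delta> where \<delta>: "0 < \<delta>" "\<And>x. length x = N \<Longrightarrow> \<delta> \<le> pmf (kernel_pow U d x) (map2 (+) x r)"
    using kernel_pow_reaches_sum[OF r(2)] by blast
  show ?thesis
  proof (rule tight_orbit_if_reaches_stationary_support[OF stat set_uniformized_subset _ \<open>0 < \<delta>\<close> \<mu>])
    fix x assume "x \<in> states N"
    then have x: "length x = N" by simp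
    \<comment> \<open>These values may depend on \<open>x\<close>: only positivity matters, to place
      \<open>map2 (+) r x\<close> in the support. By commutativity this is the state reached from
      \<open>x\<close> with the uniform bound.\<close>
    obtain d' \<delta>' where \<delta>': "0 < \<delta>'" "\<delta>' \<le> pmf (kernel_pow U d' r) (map2 (+) r x)"
      using kernel_pow_reaches_sum[OF x] r(2) by blast
    have "map2 (+) r x = map2 (+) x r"
      using x r(2) by (intro nth_equalityI) auto
    then have "map2 (+) x r \<in> set_pmf (kernel_pow U d' r)"
      using \<delta>' by (simp add: set_pmf_iff)
    then have "map2 (+) x r \<in> set_pmf \<nu>"
      using set_kernel_pow_stationary_support[OF stat r(1), of d'] by auto
    then have "pmf (kernel_pow U d x) (map2 (+) x r) \<le> measure_pmf.prob (kernel_pow U d x) (set_pmf \<nu>)"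
      by (subst measure_pmf_single[symmetric]) (intro measure_pmf.finite_measure_mono, auto)
    with \<delta>(2)[OF x] show "\<delta> \<le> measure_pmf.prob (kernel_pow U d x) (set_pmf \<nu>)" by simp
  qed
qed

end

text \<open>The strict inequality leaves room twice: for cutting the series to a finite set, and for
  replacing each liminf by the infimum over a tail that starts at a common \<open>m\<close>.\<close>

lemma liminf_sum_witness:
  fixes f :: "'a \<Rightarrow> nat \<Rightarrow> real" and w :: "'a \<Rightarrow> real"
  assumes f: "\<And>x k. x \<in> S \<Longrightarrow> 0 \<le> f x k"
    and w: "\<And>x. 0 \<le> w x" and "0 \<le> l"
    and less: "ennreal l < (\<Sum>\<^sub>\<infinity>x\<in>S. liminf (\<lambda>k. ennreal (f x k)) * ennreal (w x))"
  obtains G m g where "finite G" "G \<subseteq> S"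
    "\<And>x k. x \<in> G \<Longrightarrow> m \<le> k \<Longrightarrow> g x \<le> f x k" "l < (\<Sum>x\<in>G. g x * w x)" "1 \<le> m"
proof -
  obtain G where G: "finite G" "G \<subseteq> S"
    "ennreal l < (\<Sum>x\<in>G. liminf (\<lambda>k. ennreal (f x k)) * ennreal (w x))"
    using less by (subst (asm) nonneg_infsum_complete) (auto simp: less_SUP_iff)
  define J where "J m x = (INF k\<in>{m..}. ennreal (f x k))" for m x
  have "(\<lambda>m. J m x) \<longlonglongrightarrow> liminf (\<lambda>k. ennreal (f x k))" for x
    unfolding J_def liminf_SUP_INF
    by (intro LIMSEQ_SUP) (auto simp: incseq_def intro!: INF_superset_mono)
  then have "(\<lambda>m. ennreal (w x) * J m x) \<longlonglongrightarrow> ennreal (w x) * liminf (\<lambda>k. ennreal (f x k))" for x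
    by (intro ennreal_tendsto_cmult) auto
  then have "(\<lambda>m. \<Sum>x\<in>G. J m x * ennreal (w x)) \<longlonglongrightarrow>
      (\<Sum>x\<in>G. liminf (\<lambda>k. ennreal (f x k)) * ennreal (w x))"
    by (intro tendsto_sum) (simp add: mult.commute)
  \<comment> \<open>With \<open>1 \<le> m\<close>, a last coordinate of at least \<open>m\<close> is
    positive, so that deaths of the last class are possible there.\<close>
  then have "\<forall>\<^sub>F m in sequentially. ennreal l < (\<Sum>x\<in>G. J m x * ennreal (w x)) \<and> 1 \<le> m"
    using G(3) eventually_ge_at_top[of 1] by (intro eventually_conj order_tendstoD(1)) auto
  then obtain m where m: "ennreal l < (\<Sum>x\<in>G. J m x * ennreal (w x))" "1 \<le> m"
    by (auto simp: eventually_sequentially)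
  define g where "g x = enn2real (J m x)" for x
  have g: "ennreal (g x) = J m x" if "x \<in> G" for x
  proof -
    have "J m x \<le> ennreal (f x m)" unfolding J_def by (intro INF_lower) auto
    then have "J m x < top" by (rule le_less_trans) simp
    then show ?thesis by (simp add: g_def)
  qed
  show thesis
  proof (rule that[of G m g])
    show "g x \<le> f x k" if "x \<in> G" "m \<le> k" for x k
    proof -
      have "ennreal (g x) \<le> ennreal (f x k)"
        unfolding g[OF that(1)] J_def using that(2) by (intro INF_lower) auto
      then show ?thesis using f(1) that(1) G(2) by (subst (asm) ennreal_le_iff) auto
    qed
    have "(\<Sum>x\<in>G. J m x * ennreal (w x)) = (\<Sum>x\<in>G. ennreal (g x * w x))"
      using g w by (intro sum.cong refl) (simp add: g_def ennreal_mult)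
    also have "\<dots> = ennreal (\<Sum>x\<in>G. g x * w x)"
      using w by (intro sum_ennreal) (simp add: g_def)
    finally show "l < (\<Sum>x\<in>G. g x * w x)"
      using m(1) \<open>0 \<le> l\<close> by (simp add: ennreal_less_iff)
  qed (use G m in auto)
qed

section \<open>Laws of the processes\<close>

text \<open>The bound is asked for on the support only, because the function in view is the last
  coordinate: unbounded on the lattice, but at most \<open>k\<close> after \<open>k\<close> steps
  from 0.\<close>

lemma integral_bind_pmf_nonneg:
  fixes f :: "'a \<Rightarrow> real"
  assumes nonneg: "\<And>y. 0 \<le> f y" and le: "\<And>y. y \<in> set_pmf (bind_pmf M N) \<Longrightarrow> f y \<le> b"
  shows "(\<integral>y. f y \<partial>measure_pmf (bind_pmf M N)) = (\<integral>x. (\<integral>y. f y \<partial>measure_pmf (N x)) \<partial>measure_pmf M)"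
proof -
  have int_N: "integrable (measure_pmf (N x)) f" if "x \<in> set_pmf M" for x
    using that nonneg le by (intro integrable_pmf_bounded[where B = b]) auto
  have N_le: "(\<integral>y. f y \<partial>measure_pmf (N x)) \<le> b" if "x \<in> set_pmf M" for x
  proof -
    have "(\<integral>y. f y \<partial>measure_pmf (N x)) \<le> (\<integral>y. b \<partial>measure_pmf (N x))"
      using that le by (intro integral_pmf_mono int_N) auto
    then show ?thesis by simp
  qed
  have "ennreal (\<integral>y. f y \<partial>measure_pmf (bind_pmf M N)) = (\<integral>\<^sup>+y. f y \<partial>measure_pmf (bind_pmf M N))"
    using nonneg le by (intro nn_integral_eq_integral[symmetric] integrable_pmf_bounded[where B = b]) auto
  also have "\<dots> = (\<integral>\<^sup>+x. (\<integral>\<^sup>+y. f y \<partial>measure_pmf (N x)) \<partial>measure_pmf M)"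
    by (rule nn_integral_bind_pmf)
  also have "\<dots> = (\<integral>\<^sup>+x. ennreal (\<integral>y. f y \<partial>measure_pmf (N x)) \<partial>measure_pmf M)"
    using nonneg
    by (intro nn_integral_cong_AE) (auto simp: AE_measure_pmf_iff intro!: nn_integral_eq_integral int_N)
  also have "\<dots> = ennreal (\<integral>x. (\<integral>y. f y \<partial>measure_pmf (N x)) \<partial>measure_pmf M)"
    using nonneg N_le
    by (intro nn_integral_eq_integral integrable_pmf_bounded[where B = b])
       (auto simp: integral_nonneg_AE)
  finally show ?thesis
    using nonneg by (simp add: integral_nonneg_AE)
qed

lemma law_pmf:
  fixes Z :: "'w \<Rightarrow> 'a :: countable"
  assumes "prob_space M" "Z \<in> measurable M (count_space UNIV)"
  obtains \<mu> where "measure_pmf \<mu> = distr M (count_space UNIV) Z"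
proof -
  let ?D = "distr M (count_space UNIV) Z"
  interpret D: prob_space ?D
    using assms by (rule prob_space.prob_space_distr)
  have "AE x in ?D. measure ?D {x} \<noteq> 0"
    by (subst D.AE_support_countable) (auto intro!: exI[of _ UNIV])
  then have "measure_pmf (Abs_pmf ?D) = ?D"
    by (intro Abs_pmf_inverse) (auto intro: D.prob_space_axioms)
  then show thesis by (rule that)
qed

text \<open>Integrating the Markov property at \<open>s = 0\<close> removes the conditioning, so the
  law at time \<open>t\<close> is the initial law pushed through \<open>p t\<close>.\<close>

lemma markov_process_law:
  fixes X :: "real \<Rightarrow> 'w \<Rightarrow> 'a :: countable"
  assumes markov: "markov_process M S p X"
    and p_S: "\<And>t x. 0 \<le> t \<Longrightarrow> x \<in> S \<Longrightarrow> set_pmf (p t x) \<subseteq> S"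
  obtains \<mu> where "set_pmf \<mu> \<subseteq> S"
    "\<And>t K. 0 \<le> t \<Longrightarrow> measure M {\<omega> \<in> space M. X t \<omega> \<in> K} = measure_pmf.prob (bind_pmf \<mu> (p t)) K"
proof -
  have "prob_space M" and X_meas: "\<And>t. 0 \<le> t \<Longrightarrow> X t \<in> measurable M (count_space UNIV)"
    and X_S: "\<And>t \<omega>. 0 \<le> t \<Longrightarrow> \<omega> \<in> space M \<Longrightarrow> X t \<omega> \<in> S"
    using markov by (auto simp: markov_process_def)
  interpret prob_space M by fact
  let ?F = "natural_filtration M X 0"
  have F_sub: "sets ?F \<subseteq> sets M"
    unfolding natural_filtration_def
  proof (subst sets_measure_of)
    have "X u -` A \<inter> space M \<in> sets M" if "0 \<le> u" for u A
      using measurable_sets[OF X_meas[OF that], of A] by simp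
    then show "sigma_sets (space M) {X u -` A \<inter> space M | u A. 0 \<le> u \<and> u \<le> 0} \<subseteq> sets M"
      by (intro sets.sigma_sets_subset) auto
  qed auto
  interpret finite_measure_subalgebra M ?F
  proof unfold_locales
    have "space ?F = space M"
      unfolding natural_filtration_def by (rule space_measure_of_conv)
    with F_sub show "subalgebra M ?F"
      unfolding subalgebra_def by simp
  qed
  define law where "law t = (SOME \<mu>. measure_pmf \<mu> = distr M (count_space UNIV) (X t))" for t
  have law: "measure_pmf (law t) = distr M (count_space UNIV) (X t)" if t: "0 \<le> t" for t
  proof -
    obtain \<mu> where "measure_pmf \<mu> = distr M (count_space UNIV) (X t)"
      using law_pmf[OF \<open>prob_space M\<close> X_meas[OF t]] .
    then show ?thesis unfolding law_def by (rule someI)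
  qed
  have prob_law: "measure M {\<omega> \<in> space M. X t \<omega> \<in> K} = measure_pmf.prob (law t) K" if "0 \<le> t" for t K
    unfolding law[OF that] using X_meas[OF that]
    by (subst measure_distr) (auto intro!: arg_cong[where f = "measure M"])
  have law_S: "set_pmf (law 0) \<subseteq> S"
  proof
    fix x assume x: "x \<in> set_pmf (law 0)"
    show "x \<in> S"
    proof (rule ccontr)
      assume "x \<notin> S"
      then have empty: "{\<omega> \<in> space M. X 0 \<omega> \<in> {x}} = {}" using X_S[of 0] by auto
      have "measure_pmf.prob (law 0) {x} = 0"
        unfolding prob_law[OF order_refl, symmetric] empty by (rule measure_empty)
      with x show False by (simp add: measure_pmf_single set_pmf_iff)
    qed
  qed
  have "law t = bind_pmf (law 0) (p t)" if t: "0 \<le> t" for t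
  \<comment> \<open>One inequality suffices; outside \<open>S\<close>, where the Markov property
    says nothing, the left side is 0.\<close>
  proof (rule sym, rule pmf_eqI_le)
    fix y
    show "pmf (bind_pmf (law 0) (p t)) y \<le> pmf (law t) y"
    proof (cases "y \<in> S")
      case False
      have "set_pmf (bind_pmf (law 0) (p t)) \<subseteq> S"
        using law_S p_S[OF t] by auto
      then show ?thesis using False by (subst pmf_eq_0_set_pmf[THEN iffD2]) auto
    next
      case True
      let ?A = "{\<omega> \<in> space M. X (0 + t) \<omega> = y}"
      have A: "?A \<in> sets M"
        using measurable_sets[OF X_meas[OF t], of "{y}"] by (simp add: vimage_def Int_def conj_commute)
      have "pmf (bind_pmf (law 0) (p t)) y = (\<integral>\<omega>. pmf (p t (X 0 \<omega>)) y \<partial>M)"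
        unfolding pmf_bind law[OF order_refl] using X_meas[of 0] by (subst integral_distr) auto
      also have "\<dots> = (\<integral>\<omega>. real_cond_exp M ?F (indicator ?A) \<omega> \<partial>M)"
      proof (rule integral_cong_AE)
        have "AE \<omega> in M. real_cond_exp M ?F (indicator ?A) \<omega> = pmf (p t (X 0 \<omega>)) y"
          using markov t True unfolding markov_process_def by blast
        then show "AE \<omega> in M. pmf (p t (X 0 \<omega>)) y = real_cond_exp M ?F (indicator ?A) \<omega>"
          by (rule AE_mp) auto
        show "(\<lambda>\<omega>. pmf (p t (X 0 \<omega>)) y) \<in> borel_measurable M"
          using measurable_compose[OF X_meas[OF order_refl], of "\<lambda>x. pmf (p t x) y" borel] by simp
      qed auto
      also have "\<dots> = (\<integral>\<omega>. indicator ?A \<omega> \<partial>M)"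
        using A by (intro real_cond_exp_int integrable_const_bound[where B = 1]) (auto split: split_indicator)
      also have "\<dots> = measure M {\<omega> \<in> space M. X t \<omega> \<in> {y}}"
        using A by simp
      also have "\<dots> = pmf (law t) y"
        unfolding prob_law[OF t] by (simp add: measure_pmf_single)
      finally show ?thesis by simp
    qed
  qed
  then have "measure M {\<omega> \<in> space M. X t \<omega> \<in> K} = measure_pmf.prob (bind_pmf (law 0) (p t)) K"
    if "0 \<le> t" for t K
    using prob_law[OF that] that by metis
  with law_S show thesis by (rule that)
qed

text \<open>The initial law of the process may be any law on the lattice, and its orbit is tight all
  the same; this is the source of stability for every initial state.\<close>

lemma (in birth_death) stable_birth_death_process:
  assumes stat: "bind_pmf \<nu> U = \<nu>" "set_pmf \<nu> \<subseteq> states N"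
    and process: "birth_death_process M N lam phi X"
  shows "stable_process M (states N) X"
proof -
  obtain p where p: "transition_semigroup (states N) q p" "markov_process M (states N) p X"
    using process unfolding birth_death_process_def jump_process_def by blast
  obtain \<mu> where \<mu>: "set_pmf \<mu> \<subseteq> states N"
    "\<And>t K. 0 \<le> t \<Longrightarrow> measure M {\<omega> \<in> space M. X t \<omega> \<in> K} = measure_pmf.prob (bind_pmf \<mu> (p t)) K"
    using markov_process_law[OF p(2) set_semigroup[OF p(1)]] by blast
  have X_S: "\<And>t \<omega>. 0 \<le> t \<Longrightarrow> \<omega> \<in> space M \<Longrightarrow> X t \<omega> \<in> states N"
    using p(2) unfolding markov_process_def by blast
  show ?thesis
    unfolding stable_process_def
  proof (intro allI impI)
    fix \<epsilon> :: real assume "0 < \<epsilon>"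
    \<comment> \<open>The cap keeps \<open>1 - \<epsilon>'\<close> nonnegative, as
      \<open>prob_semigroup_ge\<close> requires.\<close>
    define \<epsilon>' where "\<epsilon>' = min \<epsilon> 1"
    have \<epsilon>': "0 < \<epsilon>'" "\<epsilon>' \<le> 1" "\<epsilon>' \<le> \<epsilon>" using \<open>0 < \<epsilon>\<close> by (auto simp: \<epsilon>'_def)
    obtain K where K: "finite K" "\<And>k. 1 - \<epsilon>' \<le> measure_pmf.prob (bind_pmf \<mu> (kernel_pow U k)) K"
      using tight_orbit_birth_death[OF stat \<mu>(1)] \<epsilon>'(1) unfolding tight_orbit_def by blast
    have "measure M {\<omega> \<in> space M. X t \<omega> \<notin> K \<inter> states N} \<le> \<epsilon>" if t: "0 \<le> t" for t
    proof -
      have "{\<omega> \<in> space M. X t \<omega> \<notin> K \<inter> states N} = {\<omega> \<in> space M. X t \<omega> \<in> - K}"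
        using X_S[OF t] by auto
      then have "measure M {\<omega> \<in> space M. X t \<omega> \<notin> K \<inter> states N} = 1 - measure_pmf.prob (bind_pmf \<mu> (p t)) K"
        by (simp only: \<mu>(2)[OF t] prob_Compl_pmf)
      moreover have "1 - \<epsilon>' \<le> measure_pmf.prob (bind_pmf \<mu> (p t)) K"
        using prob_semigroup_ge[OF p(1) \<mu>(1) _ t K(2)] \<epsilon>' by simp
      ultimately show ?thesis using \<epsilon>'(3) by linarith
    qed
    with K(1) show "\<exists>K. finite K \<and> K \<subseteq> states N \<and>
        (\<forall>t\<ge>0. measure M {\<omega> \<in> space M. X t \<omega> \<notin> K} \<le> \<epsilon>)"
      by (intro exI[of _ "K \<inter> states N"]) auto
  qed
qed

section \<open>Invariant law of the (n+1)-class kernel from the drift of the last coordinate\<close>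

lemma stationary_of_drift:
  fixes lam :: "nat \<Rightarrow> real" and g :: "nat list \<Rightarrow> real"
  assumes full: "birth_death (Suc n) lam phi B c"
    and marg: "birth_death n lam (marginal_rates phi) B c"
    and phi_local: "\<forall>i<n. \<forall>x\<in>states (Suc n). \<forall>y\<in>states (Suc n).
                      take n x = take n y \<longrightarrow> phi i x = phi i y"
    and \<pi>: "set_pmf \<pi> \<subseteq> states n"
      "bind_pmf \<pi> (uniformized (states n) (birth_death_rate n lam (marginal_rates phi)) c) = \<pi>"
    and G: "finite G" "G \<subseteq> states n"
    and g: "\<And>x k. x \<in> G \<Longrightarrow> m \<le> k \<Longrightarrow> g x \<le> phi n (x @ [k])"
    and m: "1 \<le> m" and drift: "lam n < (\<Sum>x\<in>G. g x * pmf \<pi> x)"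
  obtains \<nu> where "set_pmf \<nu> \<subseteq> states (Suc n)"
    "bind_pmf \<nu> (uniformized (states (Suc n)) (birth_death_rate (Suc n) lam phi) c) = \<nu>"
proof -
  interpret F: birth_death "Suc n" lam phi B c by (rule full)
  interpret P: birth_death n lam "marginal_rates phi" B c by (rule marg)
  \<comment> \<open>The final mass bound is \<open>\<gamma> / b\<close>, so \<open>b\<close> has to
    be positive even if \<open>B\<close> is 0.\<close>
  define b where "b = max B 1"
  have b: "0 < b" "B \<le> b" by (auto simp: b_def)
  \<comment> \<open>Transitions of the last class leave \<open>take n x\<close> fixed and drop out;
    by \<open>phi_local\<close> the other classes have the marginal rates. The common
    \<open>c\<close> makes the holding probabilities agree.\<close>
  have project: "map_pmf (take n) (F.U x) = P.U (take n x)" if "x \<in> states (Suc n)" for x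
  proof (rule pmf_eqI)
    fix y :: "nat list"
    let ?f = "\<lambda>z. indicat_real {y} (take n z)"
    have x: "length x = Suc n" "length (take n x) = n" using that by auto
    have phi_eq: "marginal_rates phi i (take n x) = phi i x" if "i < n" for i
      using phi_local[rule_format, OF that, of "take n x @ [0]" x] x by (simp add: marginal_rates_def)
    have "pmf (map_pmf (take n) (F.U x)) y = (\<integral>z. ?f z \<partial>measure_pmf (F.U x))"
      by (simp add: pmf_map indicator_vimage[symmetric] vimage_def)
    also have "\<dots> = (\<integral>z. indicator {y} z \<partial>measure_pmf (P.U (take n x)))"
      unfolding F.expectation_uniformized_birth_death[OF x(1)]
        P.expectation_uniformized_birth_death[OF x(2)]
    proof -
      have take_upd: "take n (x[i := v]) = (take n x)[i := v]" for i v
        by (rule take_update_swap)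
      have last: "(take n x)[n := v] = take n x" for v
        using x by (intro list_update_beyond) simp
      show "?f x + (\<Sum>i<Suc n. lam i * (?f (x[i := x ! i + 1]) - ?f x)
            + (if 0 < x ! i then phi i x * (?f (x[i := x ! i - 1]) - ?f x) else 0)) / c
          = indicator {y} (take n x) + (\<Sum>i<n. lam i * (indicator {y} ((take n x)[i := take n x ! i + 1])
              - indicator {y} (take n x))
            + (if 0 < take n x ! i then marginal_rates phi i (take n x)
                * (indicator {y} ((take n x)[i := take n x ! i - 1]) - indicator {y} (take n x)) else 0)) / c"
        unfolding sum.lessThan_Suc take_upd last diff_self
        by (intro arg_cong2[where f = "(+)"] arg_cong2[where f = "(/)"] refl)
           (auto simp: phi_eq intro!: sum.cong)
    qed
    also have "\<dots> = pmf (P.U (take n x)) y" by (simp add: measure_pmf_single)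
    finally show "pmf (map_pmf (take n) (F.U x)) y = pmf (P.U (take n x)) y" .
  qed
  define \<rho>0 where "\<rho>0 = map_pmf (\<lambda>x. x @ [0]) \<pi>"
  define \<rho> where "\<rho> k = bind_pmf \<rho>0 (kernel_pow F.U k)" for k
  have \<rho>_Suc: "\<rho> (Suc k) = bind_pmf (\<rho> k) F.U" for k
    unfolding \<rho>_def bind_assoc_pmf by (intro bind_pmf_cong) simp_all
  have \<rho>0_S: "set_pmf \<rho>0 \<subseteq> states (Suc n)" using \<pi>(1) by (auto simp: \<rho>0_def)
  have \<rho>_S: "set_pmf (\<rho> k) \<subseteq> states (Suc n)" for k
    using \<rho>0_S set_kernel_pow_subset[of "states (Suc n)" F.U, OF F.set_uniformized_subset]
    unfolding \<rho>_def set_bind_pmf by blast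
  have \<rho>_marg: "map_pmf (take n) (\<rho> k) = \<pi>" for k
  proof (induction k)
    case 0
    have "map_pmf (take n) \<rho>0 = map_pmf id \<pi>"
      using \<pi>(1) unfolding \<rho>0_def map_pmf_comp by (intro map_pmf_cong) auto
    then show ?case by (simp add: \<rho>_def bind_return_pmf' cong: bind_pmf_cong)
  next
    case (Suc k)
    have "map_pmf (take n) (\<rho> (Suc k)) = bind_pmf (\<rho> k) (\<lambda>x. P.U (take n x))"
      unfolding \<rho>_Suc map_bind_pmf using project \<rho>_S[of k] by (intro bind_pmf_cong) auto
    also have "\<dots> = bind_pmf (map_pmf (take n) (\<rho> k)) P.U" by (simp add: bind_map_pmf)
    finally show ?case by (simp add: Suc \<pi>(2))
  qed
  \<comment> \<open>The last coordinate starts at 0 and rises by at most one per step, so its mean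
    is finite at every time without any moment estimate.\<close>
  have \<rho>_le: "x ! n \<le> k" if "x \<in> set_pmf (\<rho> k)" for x k
    using that
  proof (induction k arbitrary: x)
    case 0
    then show ?case using \<pi>(1)
      by (auto simp: \<rho>_def \<rho>0_def nth_append)
  next
    case (Suc k)
    then obtain z where z: "z \<in> set_pmf (\<rho> k)" "x \<in> set_pmf (F.U z)" by (auto simp: \<rho>_Suc)
    then have "z \<in> states (Suc n)" using \<rho>_S by blast
    then have "x = z \<or> x \<in> F.neighbours z"
      using F.set_uniformized[of z] z(2) F.rate_eq_0[of x z] by auto
    then have "x ! n \<le> Suc (z ! n)"
      using \<open>z \<in> states (Suc n)\<close> by (auto simp: F.neighbours_def nth_list_update)
    with Suc.IH[OF z(1)] show ?case by simp
  qed
  define K where "K = (\<lambda>(x, z). x @ [z]) ` (G \<times> {..<m})"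
  define e where "e k = (\<integral>x. real (x ! n) \<partial>measure_pmf (\<rho> k))" for k
  \<comment> \<open>The gap in the drift condition: the mean decrease of the last coordinate per
    step, multiplied by \<open>c\<close>, is at least \<open>\<gamma>\<close> up to the contribution
    of \<open>K\<close>.\<close>
  define \<gamma> where "\<gamma> = (\<Sum>x\<in>G. g x * pmf \<pi> x) - lam n"
  have integrable_last: "integrable (measure_pmf (\<rho> k)) (\<lambda>x. real (x ! n))" for k
    using \<rho>_le by (intro integrable_pmf_bounded[where B = "real k"]) auto
  have step: "c * (e (Suc k) - e k) \<le> b * measure_pmf.prob (\<rho> k) K - \<gamma>" for k
  proof -
    let ?d = "\<lambda>x. (lam n - (if 0 < x ! n then phi n x else 0)) / c"
    have bound: "\<bar>if 0 < x ! n then phi n x else 0\<bar> \<le> b" if "x \<in> states (Suc n)" for x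
      using F.phi_nonneg[of n x] F.phi_le[of n x] that b by auto
    have int_d: "integrable (measure_pmf (\<rho> k)) (\<lambda>x. if 0 < x ! n then phi n x else 0)"
      by (rule integrable_pmf_bounded) (rule bound, rule subsetD[OF \<rho>_S])
    have "e (Suc k) = (\<integral>x. (\<integral>y. real (y ! n) \<partial>measure_pmf (F.U x)) \<partial>measure_pmf (\<rho> k))"
      unfolding e_def \<rho>_Suc
    proof (rule integral_bind_pmf_nonneg[where b = "real (Suc k)"])
      show "real (y ! n) \<le> real (Suc k)" if "y \<in> set_pmf (bind_pmf (\<rho> k) F.U)" for y
        using \<rho>_le[of y "Suc k"] that by (simp only: \<rho>_Suc of_nat_le_iff)
    qed simp
    also have "\<dots> = (\<integral>x. real (x ! n) + ?d x \<partial>measure_pmf (\<rho> k))"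
    proof (rule integral_cong_AE)
      have "(\<integral>y. real (y ! n) \<partial>measure_pmf (F.U x)) = real (x ! n) + ?d x"
        if "x \<in> set_pmf (\<rho> k)" for x
      proof -
        have x: "length x = Suc n" using that \<rho>_S[of k] by auto
        have "(\<Sum>i<n. lam i * (real (x[i := x ! i + 1] ! n) - real (x ! n))
            + (if 0 < x ! i then phi i x * (real (x[i := x ! i - 1] ! n) - real (x ! n)) else 0)) = 0"
          by (intro sum.neutral) auto
        then show ?thesis
          unfolding F.expectation_uniformized_birth_death[OF x] sum.lessThan_Suc
          using x by (auto simp: of_nat_diff)
      qed
      then show "AE x in measure_pmf (\<rho> k).
          (\<integral>y. real (y ! n) \<partial>measure_pmf (F.U x)) = real (x ! n) + ?d x"
        by (auto simp: AE_measure_pmf_iff)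
    qed auto
    also have "\<dots> = e k + (\<integral>x. ?d x \<partial>measure_pmf (\<rho> k))"
      unfolding e_def
      by (intro Bochner_Integration.integral_add integrable_last integrable_divide
          Bochner_Integration.integrable_diff int_d) auto
    also have "(\<integral>x. ?d x \<partial>measure_pmf (\<rho> k))
        = (lam n - (\<integral>x. (if 0 < x ! n then phi n x else 0) \<partial>measure_pmf (\<rho> k))) / c"
      using int_d by (simp add: Bochner_Integration.integral_diff)
    finally have "c * (e (Suc k) - e k)
        = lam n - (\<integral>x. (if 0 < x ! n then phi n x else 0) \<partial>measure_pmf (\<rho> k))"
      using F.c_pos by simp
    \<comment> \<open>The first \<open>n\<close> coordinates have law \<open>\<pi>\<close>, so the
      sum is the mean of \<open>g (take n w)\<close> over \<open>take n w \<in> G\<close>. The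
      active death rate dominates this function except on \<open>K\<close>, where the penalty
      \<open>b\<close> compensates.\<close>
    moreover have "(\<Sum>x\<in>G. g x * pmf \<pi> x) - b * measure_pmf.prob (\<rho> k) K
        \<le> (\<integral>x. (if 0 < x ! n then phi n x else 0) \<partial>measure_pmf (\<rho> k))"
    proof -
      have "pmf \<pi> x = (\<integral>w. indicator {x} (take n w) \<partial>measure_pmf (\<rho> k))" for x
        by (subst \<rho>_marg[of k, symmetric]) (simp add: pmf_map indicator_vimage[symmetric] vimage_def)
      then have "(\<Sum>x\<in>G. g x * pmf \<pi> x)
          = (\<Sum>x\<in>G. \<integral>w. g x * indicator {x} (take n w) \<partial>measure_pmf (\<rho> k))"
        by simp
      also have "\<dots> = (\<integral>w. (\<Sum>x\<in>G. g x * indicator {x} (take n w)) \<partial>measure_pmf (\<rho> k))"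
        by (intro Bochner_Integration.integral_sum[symmetric] integrable_mult_right
            integrable_pmf_bounded[where B = 1]) auto
      finally have "(\<Sum>x\<in>G. g x * pmf \<pi> x) - b * measure_pmf.prob (\<rho> k) K
        = (\<integral>w. (\<Sum>x\<in>G. g x * indicator {x} (take n w)) \<partial>measure_pmf (\<rho> k))
          - (\<integral>w. b * indicator K w \<partial>measure_pmf (\<rho> k))"
        by simp
      also have "\<dots> = (\<integral>w. (\<Sum>x\<in>G. g x * indicator {x} (take n w)) - b * indicator K w \<partial>measure_pmf (\<rho> k))"
        by (intro Bochner_Integration.integral_diff[symmetric] Bochner_Integration.integrable_sum
            integrable_mult_right integrable_pmf_bounded[where B = 1]) auto
      also have "\<dots> \<le> (\<integral>x. (if 0 < x ! n then phi n x else 0) \<partial>measure_pmf (\<rho> k))"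
      proof (intro integral_pmf_mono int_d)
        show "integrable (measure_pmf (\<rho> k)) (\<lambda>w. (\<Sum>x\<in>G. g x * indicator {x} (take n w)) - b * indicator K w)"
          by (intro Bochner_Integration.integrable_diff Bochner_Integration.integrable_sum
              integrable_mult_right integrable_pmf_bounded[where B = 1]) auto
        fix w assume "w \<in> set_pmf (\<rho> k)"
        then have w: "length w = Suc n" using \<rho>_S[of k] by auto
        then have w_eq: "w = take n w @ [w ! n]"
          by (metis lessI take_Suc_conv_app_nth take_all order_refl)
        have sum: "(\<Sum>x\<in>G. g x * indicat_real {x} (take n w)) = (if take n w \<in> G then g (take n w) else 0)"
          using G(1) by (simp add: indicator_def if_distrib sum.delta' cong: if_cong)
        have penalty: "0 \<le> b * indicat_real K w" using b by simp
        have phi: "0 \<le> phi n w" "phi n w \<le> b"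
          using F.phi_nonneg[of n w] F.phi_le[of n w] w b by auto
        show "(\<Sum>x\<in>G. g x * indicator {x} (take n w)) - b * indicator K w
            \<le> (if 0 < w ! n then phi n w else 0)"
        proof (cases "take n w \<in> G")
          case True
          show ?thesis
          proof (cases "w ! n < m")
            case less: True
            have "w \<in> K" unfolding K_def using True less w_eq by force
            \<comment> \<open>On \<open>G\<close> the value of \<open>g\<close> lies below the death
              rate at last coordinate \<open>m\<close>, hence below \<open>b\<close>, even though
              the actual last coordinate is smaller than \<open>m\<close>.\<close>
            moreover have "g (take n w) \<le> b"
              using g[OF True order_refl] F.phi_le[of n "take n w @ [m]"] w b by simp
            ultimately show ?thesis using True phi by (simp add: sum)
          next
            case False
            then have "g (take n w) \<le> phi n w" "0 < w ! n"
              using g[OF True, of "w ! n"] w_eq m by auto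
            then show ?thesis using True penalty by (auto simp: sum simp del: zero_le_mult_iff)
          qed
        next
          case False
          then have "(\<Sum>x\<in>G. g x * indicat_real {x} (take n w)) = 0" by (simp add: sum)
          moreover have "0 \<le> (if 0 < w ! n then phi n w else 0)" using phi by simp
          ultimately show ?thesis using penalty by linarith
        qed
      qed
      finally show ?thesis .
    qed
    ultimately show ?thesis by (simp add: \<gamma>_def)
  qed
  \<comment> \<open>The start at 0 gives \<open>e 0 = 0\<close>, so no initial term appears and the
    mass bound holds for every \<open>T\<close>.\<close>
  have telescope: "c * e T \<le> (\<Sum>k<T. b * measure_pmf.prob (\<rho> k) K - \<gamma>)" for T
  proof (induction T)
    case 0
    have "e 0 = (\<integral>x. 0 \<partial>measure_pmf (\<rho> 0))"
      unfolding e_def using \<rho>_le[of _ 0] by (intro integral_cong_AE) (auto simp: AE_measure_pmf_iff)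
    then show ?case by simp
  next
    case (Suc T)
    then show ?case using step[of T] by (simp add: algebra_simps)
  qed
  have "\<gamma> / b * real T \<le> (\<Sum>k<T. measure_pmf.prob (\<rho> k) K)" for T
  proof -
    have "0 \<le> c * e T" using F.c_pos by (auto simp: e_def intro!: mult_nonneg_nonneg integral_nonneg_AE)
    with telescope[of T] have "\<gamma> * real T \<le> b * (\<Sum>k<T. measure_pmf.prob (\<rho> k) K)"
      by (simp add: sum_subtractf sum_distrib_left mult.commute)
    then show ?thesis using b by (simp add: field_simps)
  qed
  moreover have "0 < \<gamma> / b" using b drift by (simp add: \<gamma>_def)
  moreover have "finite K" using G(1) by (simp add: K_def)
  ultimately obtain \<nu> where "bind_pmf \<nu> F.U = \<nu>" "set_pmf \<nu> \<subseteq> states (Suc n)"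
    using stationary_from_cesaro_mass[of K "\<gamma> / b" \<rho>0 F.U "states (Suc n)"] \<rho>_S
    unfolding \<rho>_def by blast
  then show thesis by (intro that)
qed

lemma stable_of_drift_condition:
  fixes lam :: "nat \<Rightarrow> real" and phi :: "nat \<Rightarrow> nat list \<Rightarrow> real"
  assumes lam_pos: "\<forall>i<Suc n. 0 < lam i"
    and phi_nonneg: "\<forall>i<Suc n. \<forall>x\<in>states (Suc n). 0 \<le> phi i x"
    and phi_bounded: "\<exists>B. \<forall>i<Suc n. \<forall>x\<in>states (Suc n). phi i x \<le> B"
    and phi_local: "\<forall>i<n. \<forall>x\<in>states (Suc n). \<forall>y\<in>states (Suc n).
                      take n x = take n y \<longrightarrow> phi i x = phi i y"
    and stationary:
      "stationary_distribution (states n) (birth_death_rate n lam (marginal_rates phi)) \<pi>"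
    and drift: "ennreal (lam n) <
        (\<Sum>\<^sub>\<infinity>x\<in>states n. liminf (\<lambda>k. ennreal (phi n (x @ [k]))) * ennreal (pmf \<pi> x))"
    and process: "birth_death_process M (Suc n) lam phi X"
  shows "stable_process M (states (Suc n)) X"
proof -
  obtain B where "\<forall>i<Suc n. \<forall>x\<in>states (Suc n). phi i x \<le> B"
    using phi_bounded by blast
  then have B: "phi i x \<le> B" if "i < Suc n" "length x = Suc n" for i x
    using that by simp
  have "0 \<le> phi n (replicate (Suc n) 0)" "phi n (replicate (Suc n) 0) \<le> B"
    using phi_nonneg B by (simp_all del: replicate_Suc)
  then have "0 \<le> B" by simp
  \<comment> \<open>One constant for both chains: the summand of the last class is nonnegative, so
    \<open>c\<close> also dominates the total for the first \<open>n\<close> classes.\<close>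
  define c where "c = (\<Sum>i<Suc n. lam i + B)"
  have "0 < c" unfolding c_def using lam_pos \<open>0 \<le> B\<close> by (intro sum_pos) (auto intro: add_pos_nonneg)
  have full: "birth_death (Suc n) lam phi B c"
    using lam_pos phi_nonneg B \<open>0 < c\<close> by unfold_locales (auto simp: c_def)
  have "(\<Sum>i<n. lam i + B) \<le> c"
    using lam_pos \<open>0 \<le> B\<close> by (simp add: c_def less_imp_le)
  then have marg: "birth_death n lam (marginal_rates phi) B c"
    using lam_pos phi_nonneg B \<open>0 < c\<close> by unfold_locales (auto simp: marginal_rates_def)
  interpret F: birth_death "Suc n" lam phi B c by (rule full)
  interpret P: birth_death n lam "marginal_rates phi" B c by (rule marg)
  \<comment> \<open>This semigroup comes with the stationarity of \<open>\<pi>\<close> and is a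
    priori unrelated to that of \<open>X\<close>; only the invariance of \<open>\<pi>\<close> under
    the uniformized kernel is carried on.\<close>
  obtain p where p: "transition_semigroup (states n) P.q p" "\<And>t. 0 \<le> t \<Longrightarrow> bind_pmf \<pi> (p t) = \<pi>"
    and \<pi>: "set_pmf \<pi> \<subseteq> states n"
    using stationary unfolding stationary_distribution_def by blast
  have stat: "bind_pmf \<pi> P.U = \<pi>"
    using P.stationary_uniformized[OF p(1) \<pi> p(2)] .
  have nonneg: "0 \<le> phi n (x @ [k])" if "x \<in> states n" for x k
    using phi_nonneg that by simp
  obtain G m g where G: "finite G" "G \<subseteq> states n"
    "\<And>x k. x \<in> G \<Longrightarrow> m \<le> k \<Longrightarrow> g x \<le> phi n (x @ [k])"
    "lam n < (\<Sum>x\<in>G. g x * pmf \<pi> x)" "1 \<le> m"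
    by (rule liminf_sum_witness[OF nonneg pmf_nonneg _ drift]) (use lam_pos in auto)
  obtain \<nu> where "set_pmf \<nu> \<subseteq> states (Suc n)" "bind_pmf \<nu> F.U = \<nu>"
    by (rule stationary_of_drift[OF full marg phi_local \<pi> stat G(1-3,5,4)])
  then show ?thesis by (intro F.stable_birth_death_process process)
qed

text \<open>\<open>birth_death_process\<close> fixes no initial law, so quantifying over all
  \<open>Y\<close> with these rates expresses independence of the initial state. The second part
  reduces to the first: the liminf no longer depends on \<open>x\<close>, and the weights of
  \<open>\<pi>\<close> sum to 1.\<close>

theorem proposition5:
  fixes n :: nat
    and lam :: "nat \<Rightarrow> real"
    and phi :: "nat \<Rightarrow> nat list \<Rightarrow> real"
    and M :: "'w measure"
    and X :: "real \<Rightarrow> 'w \<Rightarrow> nat list"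
    and \<pi> :: "nat list pmf"
  assumes lam_pos: "\<forall>i<Suc n. 0 < lam i"
    and phi_nonneg: "\<forall>i<Suc n. \<forall>x\<in>states (Suc n). 0 \<le> phi i x"
    and phi_bounded: "\<exists>B. \<forall>i<Suc n. \<forall>x\<in>states (Suc n). phi i x \<le> B"
    and phi_local: "\<forall>i<n. \<forall>x\<in>states (Suc n). \<forall>y\<in>states (Suc n).
                      take n x = take n y \<longrightarrow> phi i x = phi i y"
    and process: "birth_death_process M (Suc n) lam phi X"
    and i_stable: "stable_process M (states n) (\<lambda>t \<omega>. take n (X t \<omega>))"
    and i_stationary:
      "stationary_distribution (states n) (birth_death_rate n lam (marginal_rates phi)) \<pi>"
  shows
    "(ennreal (lam n) <
        (\<Sum>\<^sub>\<infinity>x\<in>states n. liminf (\<lambda>k. ennreal (phi n (x @ [k]))) * ennreal (pmf \<pi> x))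
      \<longrightarrow> stable_process M (states (Suc n)) X)
     \<and>
     (\<forall>psi :: nat \<Rightarrow> real.
        (\<forall>x\<in>states (Suc n). phi n x = psi (x ! n)) \<and>
        ennreal (lam n) < liminf (\<lambda>k. ennreal (psi k))
      \<longrightarrow> stable_process M (states (Suc n)) X \<and>
          (\<forall>(M' :: 'v measure) Y. birth_death_process M' (Suc n) lam phi Y
             \<longrightarrow> stable_process M' (states (Suc n)) Y))"
proof -
  note stable = stable_of_drift_condition[OF lam_pos phi_nonneg phi_bounded phi_local i_stationary]
  have drift: "ennreal (lam n) <
      (\<Sum>\<^sub>\<infinity>x\<in>states n. liminf (\<lambda>k. ennreal (phi n (x @ [k]))) * ennreal (pmf \<pi> x))"
    if psi: "\<forall>x\<in>states (Suc n). phi n x = psi (x ! n)"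
      and less: "ennreal (lam n) < liminf (\<lambda>k. ennreal (psi k))" for psi :: "nat \<Rightarrow> real"
  proof -
    \<comment> \<open>An intermediate real \<open>l\<close> leaves room for replacing
      \<open>\<pi>\<close> by a finite part of it.\<close>
    obtain l where l: "lam n < l" "ennreal l < liminf (\<lambda>k. ennreal (psi k))"
    proof -
      obtain L where L: "ennreal (lam n) < L" "L < liminf (\<lambda>k. ennreal (psi k))"
        using dense[OF less] by blast
      then have "L < top" by (auto intro: less_le_trans)
      then obtain l where "0 \<le> l" "L = ennreal l"
        by (cases L) auto
      with L show ?thesis
        using lam_pos by (intro that[of l]) (auto simp: ennreal_less_iff less_imp_le)
    qed
    have lam_n: "0 < lam n" using lam_pos by simp
    \<comment> \<open>With this choice \<open>l * (1 - \<epsilon>)\<close> is the midpoint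
      \<open>(l + lam n) / 2\<close>, still above \<open>lam n\<close>.\<close>
    define \<epsilon> where "\<epsilon> = (l - lam n) / (2 * l)"
    have "0 < \<epsilon>" using l(1) lam_n by (simp add: \<epsilon>_def)
    then obtain G where G: "finite G" "G \<subseteq> set_pmf \<pi>" "1 - \<epsilon> \<le> measure_pmf.prob \<pi> G"
      using pmf_finite_approx[of \<epsilon> \<pi>] by blast
    have G_S: "G \<subseteq> states n"
      using G(2) i_stationary by (auto simp: stationary_distribution_def)
    have "lam n < l * (1 - \<epsilon>)"
      using l(1) lam_n by (simp add: \<epsilon>_def field_simps)
    also have "\<dots> \<le> l * measure_pmf.prob \<pi> G"
      using G(3) l(1) lam_n by (intro mult_left_mono) auto
    also have "\<dots> = (\<Sum>x\<in>G. l * pmf \<pi> x)"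
      by (simp add: measure_measure_pmf_finite[OF G(1)] sum_distrib_left)
    finally have "ennreal (lam n) < ennreal (\<Sum>x\<in>G. l * pmf \<pi> x)"
      using lam_n by (simp add: ennreal_less_iff)
    also have "\<dots> = (\<Sum>x\<in>G. ennreal (l * pmf \<pi> x))"
      using l(1) lam_n by (intro sum_ennreal[symmetric]) auto
    also have "\<dots> \<le> (\<Sum>x\<in>G. liminf (\<lambda>k. ennreal (phi n (x @ [k]))) * ennreal (pmf \<pi> x))"
    proof (intro sum_mono)
      fix x assume "x \<in> G"
      then have x: "length x = n" using G_S by auto
      then have "phi n (x @ [k]) = psi k" for k using psi by (simp add: nth_append)
      then show "ennreal (l * pmf \<pi> x) \<le> liminf (\<lambda>k. ennreal (phi n (x @ [k]))) * ennreal (pmf \<pi> x)"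
        using l lam_n by (auto simp: ennreal_mult intro!: mult_right_mono)
    qed
    also have "\<dots> \<le> (\<Sum>\<^sub>\<infinity>x\<in>states n. liminf (\<lambda>k. ennreal (phi n (x @ [k]))) * ennreal (pmf \<pi> x))"
      using G(1) G_S by (subst nonneg_infsum_complete) (auto intro!: SUP_upper)
    finally show ?thesis .
  qed
  have "stable_process M (states (Suc n)) X"
    if "ennreal (lam n) <
        (\<Sum>\<^sub>\<infinity>x\<in>states n. liminf (\<lambda>k. ennreal (phi n (x @ [k]))) * ennreal (pmf \<pi> x))"
    using that by (rule stable[OF _ process])
  moreover have "stable_process M (states (Suc n)) X \<and>
          (\<forall>(M' :: 'v measure) Y. birth_death_process M' (Suc n) lam phi Y
             \<longrightarrow> stable_process M' (states (Suc n)) Y)"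
    if "(\<forall>x\<in>states (Suc n). phi n x = psi (x ! n)) \<and>
        ennreal (lam n) < liminf (\<lambda>k. ennreal (psi k))" for psi
  proof -
    from that have "ennreal (lam n) <
        (\<Sum>\<^sub>\<infinity>x\<in>states n. liminf (\<lambda>k. ennreal (phi n (x @ [k]))) * ennreal (pmf \<pi> x))"
      by (intro drift[of psi]) auto
    then show ?thesis
      using process by (auto intro: stable_of_drift_condition[OF lam_pos phi_nonneg phi_bounded
            phi_local i_stationary])
  qed
  ultimately show ?thesis by blast
qed

end
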